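(* Let $n>m\ge3$, let $W_{m,n}$ act on $\mathcal{L}=\mathbb{K}(f_1,\dots,f_m;\tau_1,\dots,\tau_n)$ as in the context, and let $(\tau(\Lambda))_{\Lambda\in M_{m,n}}$ be the lattice $\tau$-functions. Then for any mutually distinct indices $i,j,k,l_1,\dots,l_{m-2}\in\{1,\dots,n\}$, setting $\Lambda=e_0-e_{l_1}-\dots-e_{l_{m-2}}$ and $\lambda=\langle\Lambda,\cdot\rangle=\varepsilon_0-\varepsilon_{l_1}-\dots-\varepsilon_{l_{m-2}}$, $$[\varepsilon_{j,k}][\lambda-\varepsilon_j-\varepsilon_k]\tau(e_i)\tau(\Lambda-e_i)+[\varepsilon_{k,i}][\lambda-\varepsilon_k-\varepsilon_i]\tau(e_j)\tau(\Lambda-e_j)+[\varepsilon_{i,j}][\lambda-\varepsilon_i-\varepsilon_j]\tau(e_k)\tau(\Lambda-e_k)=0.$$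
   Context: $[x]$ is a fixed nonzero odd holomorphic function on $\mathbb{C}$ satisfying $[x+y][x-y][u+v][u-v]=[x+u][x-u][y+v][y-v]-[x+v][x-v][y+u][y-u]$. $L_{m,n}=\bigoplus_{j=0}^n\mathbb{Z}e_j$, $\mathfrak{h}=L_{m,n}\otimes\mathbb{C}$, with symmetric form $\langle e_0,e_0\rangle=-(m-2)$, $\langle e_j,e_j\rangle=1$ ($j\ge1$), $\langle e_i,e_j\rangle=0$ ($i\ne j$); $\varepsilon_j=\langle e_j,\cdot\rangle$, $\varepsilon_{i,j}=\varepsilon_i-\varepsilon_j$; $h_0=e_0-e_1-\dots-e_m$, $h_k=e_k-e_{k+1}$, $\alpha_k=\langle h_k,\cdot\rangle$. $W_{m,n}$ is the Coxeter group on $s_0,\dots,s_{n-1}$ for the tree $T_{2,m,n-m}$ (chain $1-\dots-(n-1)$, node $0$ joined to node $m$), acting on $L_{m,n}$ by $s_k.\Lambda=\Lambda-\langle h_k,\Lambda\rangle h_k$ and on $\mathfrak{h}^*$ by $s_k.\lambda=\lambda-\langle h_k,\lambda\rangle\alpha_k$. $\mathbb{K}$ is the field of meromorphic functions on $\mathfrak{h}$ generated by $[\alpha]:h\mapsto[\alpha(h)]$ for $\alpha$ in $W_{m,n}\{\alpha_0,\dots,\alpha_{n-1}\}$, with $w([\alpha])=[w.\alpha]$. $W_{m,n}$ acts on $\mathcal{L}$ by: $s_0(\tau_j)=\tau_jf_j$ ($j\le m$), $s_0(\tau_j)=\tau_j$ ($j>m$), $s_k(\tau_j)=\tau_{s_k(j)}$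 ($k\ge1$, $s_k(j)$ the image under the transposition $(k,k+1)$); $s_0(f_i)=1/f_i$, $s_k(f_i)=f_{s_k(i)}$ ($1\le k\le m-1$), $s_k(f_i)=f_i$ ($m+1\le k\le n-1$), $s_m(f_m)=\frac{\tau_m}{\tau_{m+1}}f_m$ and for $i\le m-1$: $s_m(f_i)=\frac{\tau_m}{\tau_{m+1}}\cdot\frac{[\alpha_0+\varepsilon_{m,m+1}][\varepsilon_{i,m+1}]f_i-[\alpha_0+\varepsilon_{i,m+1}][\varepsilon_{m,m+1}]f_m}{[\alpha_0][\varepsilon_{i,m}]}$. $M_{m,n}=W_{m,n}.e_n=W_{m,n}\{e_1,\dots,e_n\}\subset L_{m,n}$. The lattice $\tau$-function is $\tau(\Lambda)=w(\tau_n)$ for any $w\in W_{m,n}$ with $w.e_n=\Lambda$ (well defined since the stabilizer of $e_n$ fixes $\tau_n$); in particular $\tau(e_j)=\tau_j$. *)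

theory Defs
  imports "HOL-Analysis.Analysis"
begin

text \<open>
Lattice L_{m,n}: vectors are coefficient functions nat => int on the basis e_0,...,e_n
(coordinates beyond n are ignored by all operations).
The Cartan space h = L (x) C: points are coefficient functions nat => complex.
\<close>

definition evec :: "nat \<Rightarrow> nat \<Rightarrow> int" where
  "evec j = (\<lambda>t. if t = j then 1 else 0)"

definition lform :: "nat \<Rightarrow> nat \<Rightarrow> (nat \<Rightarrow> int) \<Rightarrow> (nat \<Rightarrow> int) \<Rightarrow> int" where
  "lform m n a b = - (int m - 2) * a 0 * b 0 + (\<Sum>t=1..n. a t * b t)"

definition cform :: "nat \<Rightarrow> nat \<Rightarrow> (nat \<Rightarrow> complex) \<Rightarrow> (nat \<Rightarrow> complex) \<Rightarrow> complex" where
  "cform m n a b = - (of_nat m - 2) * a 0 * b 0 + (\<Sum>t=1..n. a t * b t)"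

definition hvec :: "nat \<Rightarrow> nat \<Rightarrow> nat \<Rightarrow> int" where
  "hvec m k = (if k = 0 then (\<lambda>t. evec 0 t - (\<Sum>r=1..m. evec r t))
               else (\<lambda>t. evec k t - evec (k+1) t))"

definition eps :: "nat \<Rightarrow> nat \<Rightarrow> nat \<Rightarrow> (nat \<Rightarrow> complex) \<Rightarrow> complex" where
  "eps m n j h = cform m n (\<lambda>t. of_int (evec j t)) h"

definition eps2 :: "nat \<Rightarrow> nat \<Rightarrow> nat \<Rightarrow> nat \<Rightarrow> (nat \<Rightarrow> complex) \<Rightarrow> complex" where
  "eps2 m n i j h = eps m n i h - eps m n j h"

definition alpha :: "nat \<Rightarrow> nat \<Rightarrow> nat \<Rightarrow> (nat \<Rightarrow> complex) \<Rightarrow> complex" where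
  "alpha m n k h = cform m n (\<lambda>t. of_int (hvec m k t)) h"

definition lrefl :: "nat \<Rightarrow> nat \<Rightarrow> nat \<Rightarrow> (nat \<Rightarrow> int) \<Rightarrow> (nat \<Rightarrow> int)" where
  "lrefl m n k a = (\<lambda>t. a t - lform m n (hvec m k) a * hvec m k t)"

definition hrefl :: "nat \<Rightarrow> nat \<Rightarrow> nat \<Rightarrow> (nat \<Rightarrow> complex) \<Rightarrow> (nat \<Rightarrow> complex)" where
  "hrefl m n k h = (\<lambda>t. h t - alpha m n k h * of_int (hvec m k t))"

definition lat_act :: "nat \<Rightarrow> nat \<Rightarrow> nat list \<Rightarrow> (nat \<Rightarrow> int) \<Rightarrow> (nat \<Rightarrow> int)" where
  "lat_act m n ws a = foldr (lrefl m n) ws a"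

definition transp :: "nat \<Rightarrow> nat \<Rightarrow> nat" where
  "transp k i = (if i = k then k + 1 else if i = k + 1 then k else i)"

text \<open>
Elements of L = K(f_1..f_m; tau_1..tau_n) are represented by the meromorphic functions
Phi h x y on h x C^m x C^n obtained by substituting f_i := x i, tau_j := y j, the
coefficients in K being functions of h (evaluated pointwise, with Isabelle's
convention z / 0 = 0).  The images of the generators under s_k:
\<close>
definition fimg :: "(complex \<Rightarrow> complex) \<Rightarrow> nat \<Rightarrow> nat \<Rightarrow> nat \<Rightarrow>
    (nat \<Rightarrow> complex) \<Rightarrow> (nat \<Rightarrow> complex) \<Rightarrow> (nat \<Rightarrow> complex) \<Rightarrow> nat \<Rightarrow> complex" where
  "fimg br m n k h x y i =
    (if i < 1 \<or> m < i then x i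
     else if k = 0 then 1 / x i
     else if k < m then x (transp k i)
     else if k = m then
       (if i = m then y m / y (m+1) * x m
        else y m / y (m+1) *
          (br (alpha m n 0 h + eps2 m n m (m+1) h) * br (eps2 m n i (m+1) h) * x i
           - br (alpha m n 0 h + eps2 m n i (m+1) h) * br (eps2 m n m (m+1) h) * x m)
          / (br (alpha m n 0 h) * br (eps2 m n i m h)))
     else x i)"

definition timg :: "nat \<Rightarrow> nat \<Rightarrow>
    (nat \<Rightarrow> complex) \<Rightarrow> (nat \<Rightarrow> complex) \<Rightarrow> nat \<Rightarrow> complex" where
  "timg m k x y j =
    (if k = 0 then (if 1 \<le> j \<and> j \<le> m then y j * x j else y j)
     else y (transp k j))"

text \<open>the field automorphism s_k of L, acting on representatives:
  coefficients c in K go to c o s_k (i.e. s_k[alpha] = [s_k.alpha]),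
  generators go to their prescribed images\<close>
definition act :: "(complex \<Rightarrow> complex) \<Rightarrow> nat \<Rightarrow> nat \<Rightarrow> nat \<Rightarrow>
    ((nat \<Rightarrow> complex) \<Rightarrow> (nat \<Rightarrow> complex) \<Rightarrow> (nat \<Rightarrow> complex) \<Rightarrow> complex) \<Rightarrow>
    ((nat \<Rightarrow> complex) \<Rightarrow> (nat \<Rightarrow> complex) \<Rightarrow> (nat \<Rightarrow> complex) \<Rightarrow> complex)" where
  "act br m n k F = (\<lambda>h x y. F (hrefl m n k h) (fimg br m n k h x y) (timg m k x y))"

definition word_act :: "(complex \<Rightarrow> complex) \<Rightarrow> nat \<Rightarrow> nat \<Rightarrow> nat list \<Rightarrow>
    ((nat \<Rightarrow> complex) \<Rightarrow> (nat \<Rightarrow> complex) \<Rightarrow> (nat \<Rightarrow> complex) \<Rightarrow> complex) \<Rightarrow>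
    ((nat \<Rightarrow> complex) \<Rightarrow> (nat \<Rightarrow> complex) \<Rightarrow> (nat \<Rightarrow> complex) \<Rightarrow> complex)" where
  "word_act br m n ws F = foldr (act br m n) ws F"

definition tau_gen :: "nat \<Rightarrow> (nat \<Rightarrow> complex) \<Rightarrow> (nat \<Rightarrow> complex) \<Rightarrow> (nat \<Rightarrow> complex) \<Rightarrow> complex" where
  "tau_gen j = (\<lambda>h x y. y j)"

end

theory Submission
  imports Defs "HOL-Complex_Analysis.Complex_Analysis"
begin

text \<open>
  Replacing \<open>f_i\<close> by \<open>u_i = \<tau>_i f_i = \<tau>(s_0 e_i)\<close> makes all generators act by permutations of the
  coordinates, except that \<open>s_m\<close> changes \<open>u_1, \<dots>, u_{m-1}\<close> by a fraction linear in \<open>u_i, u_m\<close>; the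
  three-term relation is needed only for the braid relation of \<open>s_m\<close> and \<open>s_{m+1}\<close>.
  Independence of \<open>\<tau>(\<Lambda>)\<close> from the word follows from the Coxeter relations by descending
  from \<open>\<Lambda>\<close> to the antidominant vector \<open>e_n\<close>: a step along \<open>s_k\<close> is taken when
  \<open>\<langle>h_k, \<Lambda>\<rangle> > 0\<close>, and any two first steps are completed to a common rank-two descent.
  For \<open>(i, j, k) = (m-1, m, m+1)\<close> and \<open>l_r = r\<close> the bilinear relation is the definition of
  \<open>s_m(u_{m-1})\<close>; all other cases are its images under permutations of \<open>1, \<dots>, n\<close>.
\<close>

subsection \<open>Properties on an open dense set\<close>

text \<open>Field elements are represented by pointwise functions with division by zero giving 0, so
  the Coxeter relations may fail on polar sets and equality is read on an open dense set; two merely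
  dense sets need not meet. This equality must survive substitution, although preimages of dense
  sets under continuous maps need not be dense. It does, because each generator moves points by an
  involution that is continuous off its poles. In the coordinates \<open>u\<close>,
  \<open>s_0\<close> exchanges \<open>u_i\<close> and \<open>tau_i\<close> for
  \<open>i \<le> m\<close> instead of inverting \<open>f_i\<close>, so only \<open>s_m\<close> has
  poles, and one open dense set stable under \<open>s_m\<close> carries all relations. The shape of
  \<open>s_m(u_i)\<close> comes from the lattice: it is the tau-function of
  \<open>e_0 - e_{m+1}\<close> minus all \<open>e_r\<close> with \<open>1 \<le> r < m\<close>,
  \<open>r \<noteq> i\<close>, a vector symmetric in \<open>i\<close> and \<open>m\<close> and
  orthogonal to \<open>h_0\<close>, and the fraction has both symmetries. The orbit argument handles
  pairs of a vector and a function; invariance under the simple reflections that fix a vector is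
  derived along the way.\<close>

definition generic :: "('a::topological_space \<Rightarrow> bool) \<Rightarrow> bool" where
  "generic P \<longleftrightarrow> (\<exists>S. open S \<and> closure S = UNIV \<and> (\<forall>p\<in>S. P p))"

lemma closure_UNIV_iff:
  "closure S = UNIV \<longleftrightarrow> (\<forall>V. open V \<longrightarrow> V \<noteq> {} \<longrightarrow> V \<inter> S \<noteq> {})"
proof
  assume "closure S = UNIV"
  then show "\<forall>V. open V \<longrightarrow> V \<noteq> {} \<longrightarrow> V \<inter> S \<noteq> {}"
    by (metis Int_UNIV_right open_Int_closure_eq_empty)
next
  assume *: "\<forall>V. open V \<longrightarrow> V \<noteq> {} \<longrightarrow> V \<inter> S \<noteq> {}"
  have "- closure S \<inter> S = {}" using closure_subset by blast
  then have "- closure S = {}" using * by (meson closed_closure open_Compl)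
  then show "closure S = UNIV" by blast
qed

lemma generic_mono: "generic P \<Longrightarrow> (\<And>p. P p \<Longrightarrow> Q p) \<Longrightarrow> generic Q"
  unfolding generic_def by blast

lemma generic_imp_closure: "generic P \<Longrightarrow> closure (Collect P) = UNIV"
  unfolding generic_def using closure_mono[of _ "Collect P"] by blast

lemma generic_True: "generic (\<lambda>p. True)"
  unfolding generic_def by (intro exI[of _ UNIV]) auto

lemma generic_conj:
  assumes "generic P" "generic Q"
  shows "generic (\<lambda>p. P p \<and> Q p)"
proof -
  obtain S1 where S1: "open S1" "closure S1 = UNIV" "\<forall>p\<in>S1. P p"
    using assms(1) unfolding generic_def by blast
  obtain S2 where S2: "open S2" "closure S2 = UNIV" "\<forall>p\<in>S2. Q p"
    using assms(2) unfolding generic_def by blast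
  have "closure (S1 \<inter> S2) = UNIV"
    unfolding closure_UNIV_iff
    by (metis (no_types, opaque_lifting) S1(1,2) S2(2) closure_UNIV_iff inf_assoc open_Int)
  then show ?thesis
    unfolding generic_def using S1 S2 by (intro exI[of _ "S1 \<inter> S2"]) auto
qed

lemma generic_ball:
  assumes "finite I" "\<And>i. i \<in> I \<Longrightarrow> generic (P i)"
  shows "generic (\<lambda>p. \<forall>i\<in>I. P i p)"
  using assms
proof (induction I rule: finite_induct)
  case empty
  then show ?case by (simp add: generic_True)
next
  case (insert i I)
  then have "generic (\<lambda>p. P i p \<and> (\<forall>i\<in>I. P i p))" by (intro generic_conj) auto
  then show ?case by (rule generic_mono) auto
qed

text \<open>Continuity makes the preimage of \<open>S\<close> open, but not dense. For density, an
  open \<open>V\<close> meeting \<open>U\<close> is carried through \<open>G\<close> to an open set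
  around \<open>T p\<close>, which meets \<open>S\<close> at some \<open>q\<close>; then
  \<open>G q\<close> lies in \<open>V\<close> and \<open>T\<close> sends it back to
  \<open>q\<close>.\<close>

lemma generic_pullback:
  fixes T :: "'a::topological_space \<Rightarrow> 'b::topological_space"
  assumes P: "generic P"
    and U: "open U" "closure U = UNIV" and U': "open U'"
    and cT: "continuous_on U T" and cG: "continuous_on U' G"
    and TU: "\<And>p. p \<in> U \<Longrightarrow> T p \<in> U'"
    and GT: "\<And>p. p \<in> U \<Longrightarrow> G (T p) = p" and TG: "\<And>q. q \<in> U' \<Longrightarrow> T (G q) = q"
  shows "generic (\<lambda>p. p \<in> U \<and> P (T p))"
proof -
  obtain S where S: "open S" "closure S = UNIV" "\<forall>p\<in>S. P p"
    using P unfolding generic_def by blast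
  have o: "open (T -` S \<inter> U)"
    using cT U(1) S(1) by (metis continuous_on_open_vimage)
  have "closure (T -` S \<inter> U) = UNIV"
    unfolding closure_UNIV_iff
  proof (intro allI impI)
    fix V :: "'a set" assume V: "open V" "V \<noteq> {}"
    have "V \<inter> U \<noteq> {}" using U(2) V unfolding closure_UNIV_iff by blast
    then obtain p where p: "p \<in> V" "p \<in> U" by blast
    have "open (G -` (V \<inter> U) \<inter> U')"
      using cG U' V(1) U(1) by (metis continuous_on_open_vimage open_Int)
    moreover have "T p \<in> G -` (V \<inter> U) \<inter> U'" using p GT TU by auto
    ultimately obtain q where q: "q \<in> S" "G q \<in> V" "G q \<in> U" "q \<in> U'"
      using S(2) unfolding closure_UNIV_iff by blast
    then have "G q \<in> V \<inter> (T -` S \<inter> U)" using TG by auto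
    then show "V \<inter> (T -` S \<inter> U) \<noteq> {}" by blast
  qed
  then show ?thesis
    unfolding generic_def using o S(3) by (intro exI[of _ "T -` S \<inter> U"]) auto
qed

text \<open>A continuous section through a point of \<open>V\<close> pulls \<open>V\<close> back to
  a nonempty open set of values, so density is inherited from the target. This reduces density in an
  infinite product to density in one complex variable.\<close>

lemma generic_section:
  fixes \<phi> :: "'a::topological_space \<Rightarrow> 'b::topological_space"
  assumes Q: "generic Q" and c: "continuous_on UNIV \<phi>"
    and sec: "\<And>p. \<exists>\<gamma>. continuous_on UNIV \<gamma> \<and> \<gamma> (\<phi> p) = p \<and> (\<forall>z. \<phi> (\<gamma> z) = z)"
  shows "generic (\<lambda>p. Q (\<phi> p))"
proof -
  obtain S where S: "open S" "closure S = UNIV" "\<forall>p\<in>S. Q p"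
    using Q unfolding generic_def by blast
  have "closure (\<phi> -` S) = UNIV"
    unfolding closure_UNIV_iff
  proof (intro allI impI)
    fix V :: "'a set" assume V: "open V" "V \<noteq> {}"
    then obtain p where p: "p \<in> V" by blast
    obtain \<gamma> where \<gamma>: "continuous_on UNIV \<gamma>" "\<gamma> (\<phi> p) = p" "\<And>z. \<phi> (\<gamma> z) = z" using sec by blast
    have "open (\<gamma> -` V)" using \<gamma>(1) V(1) by (simp add: open_vimage)
    moreover have "\<phi> p \<in> \<gamma> -` V" using \<gamma> p by simp
    ultimately obtain z where "z \<in> S" "\<gamma> z \<in> V" using S(2) unfolding closure_UNIV_iff by blast
    then show "V \<inter> \<phi> -` S \<noteq> {}" using \<gamma>(3) by blast
  qed
  moreover have "open (\<phi> -` S)" using c S(1) by (simp add: open_vimage)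
  ultimately show ?thesis
    unfolding generic_def using S(3) by (intro exI[of _ "\<phi> -` S"]) auto
qed

lemma generic_nonzero_holomorphic:
  assumes "f holomorphic_on UNIV" "\<exists>z. f z \<noteq> 0"
  shows "generic (\<lambda>z. f z \<noteq> 0)"
proof -
  have c: "continuous_on UNIV f" using assms(1) holomorphic_on_imp_continuous_on by blast
  have "open {z. f z \<noteq> 0}"
    using open_Collect_neq[OF c continuous_on_const] by simp
  moreover have "closure {z. f z \<noteq> 0} = UNIV"
    unfolding closure_UNIV_iff
  proof (intro allI impI notI)
    fix V :: "complex set" assume V: "open V" "V \<noteq> {}" "V \<inter> {z. f z \<noteq> 0} = {}"
    obtain w where "f w \<noteq> 0" using assms by blast
    moreover have "f w = 0"
      by (rule analytic_continuation_open[of V UNIV f "\<lambda>_. 0"]) (use V assms in auto)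
    ultimately show False by simp
  qed
  ultimately show ?thesis unfolding generic_def by blast
qed

lemma continuous_fun_upd:
  "continuous_on UNIV (\<lambda>z. h(j := g z))" if "continuous_on UNIV g"
  for h :: "'i \<Rightarrow> 'a::topological_space" and g :: "'b::topological_space \<Rightarrow> 'a"
proof (rule continuous_on_coordinatewise_then_product)
  fix i show "continuous_on UNIV (\<lambda>z. (h(j := g z)) i)"
    using that by (cases "i = j") (auto intro: continuous_intros)
qed

subsection \<open>Descent in a Coxeter orbit\<close>

text \<open>\<open>s\<close> is an action with integer pairings \<open>pr\<close>, \<open>adj\<close> the simply laced Coxeter diagram, and \<open>act\<close> an
  action up to \<open>eqv\<close>; the base vector \<open>v0\<close> is antidominant.\<close>

locale orbit_cocycle =
  fixes I :: "nat set" and s :: "nat \<Rightarrow> 'v \<Rightarrow> 'v" and pr :: "nat \<Rightarrow> 'v \<Rightarrow> int"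
    and adj :: "nat \<Rightarrow> nat \<Rightarrow> bool"
    and act :: "nat \<Rightarrow> 'f \<Rightarrow> 'f" and eqv :: "'f \<Rightarrow> 'f \<Rightarrow> bool"
    and v0 :: 'v and F0 :: 'f
  assumes s_s: "k \<in> I \<Longrightarrow> s k (s k v) = v"
    and s_fix: "k \<in> I \<Longrightarrow> pr k v = 0 \<Longrightarrow> s k v = v"
    and pr_self: "k \<in> I \<Longrightarrow> pr k (s k v) = - pr k v"
    and pr_comm: "k \<in> I \<Longrightarrow> l \<in> I \<Longrightarrow> k \<noteq> l \<Longrightarrow> \<not> adj k l \<Longrightarrow> pr k (s l v) = pr k v"
    and pr_adj: "k \<in> I \<Longrightarrow> l \<in> I \<Longrightarrow> adj k l \<Longrightarrow> pr k (s l v) = pr k v + pr l v"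
    and s_comm: "k \<in> I \<Longrightarrow> l \<in> I \<Longrightarrow> k \<noteq> l \<Longrightarrow> \<not> adj k l \<Longrightarrow> s k (s l v) = s l (s k v)"
    and s_braid: "k \<in> I \<Longrightarrow> l \<in> I \<Longrightarrow> adj k l \<Longrightarrow> s k (s l (s k v)) = s l (s k (s l v))"
    and adj_sym: "adj k l \<Longrightarrow> adj l k"
    and eqv_refl: "eqv F F" and eqv_sym: "eqv F G \<Longrightarrow> eqv G F"
    and eqv_trans: "eqv F G \<Longrightarrow> eqv G H \<Longrightarrow> eqv F H"
    and act_cong: "k \<in> I \<Longrightarrow> eqv F G \<Longrightarrow> eqv (act k F) (act k G)"
    and act_act: "k \<in> I \<Longrightarrow> eqv (act k (act k F)) F"
    and act_comm: "k \<in> I \<Longrightarrow> l \<in> I \<Longrightarrow> k \<noteq> l \<Longrightarrow> \<not> adj k l \<Longrightarrow> eqv (act k (act l F)) (act l (act k F))"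
    and act_braid: "k \<in> I \<Longrightarrow> l \<in> I \<Longrightarrow> adj k l \<Longrightarrow>
      eqv (act k (act l (act k F))) (act l (act k (act l F)))"
    and base_le: "k \<in> I \<Longrightarrow> pr k v0 \<le> 0"
    and base_fix: "k \<in> I \<Longrightarrow> pr k v0 = 0 \<Longrightarrow> eqv (act k F0) F0"
begin

text \<open>\<open>N\<close> counts strict ascents from the antidominant base vector and is the
  measure for all inductions below. The function is kept only up to \<open>eqv\<close>, so a
  relation may be applied at any stage.\<close>

inductive asc :: "nat \<Rightarrow> 'v \<Rightarrow> 'f \<Rightarrow> bool" where
  asc_0: "eqv F F0 \<Longrightarrow> asc 0 v0 F"
| asc_Suc: "asc N v F \<Longrightarrow> k \<in> I \<Longrightarrow> pr k v < 0 \<Longrightarrow> eqv G (act k F) \<Longrightarrow> asc (Suc N) (s k v) G"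

lemma asc_eqv: "asc N v F \<Longrightarrow> eqv F G \<Longrightarrow> asc N v G"
proof -
  assume "asc N v F" "eqv F G"
  then show "asc N v G"
  proof (cases rule: asc.cases)
    case asc_0
    then show ?thesis using asc.asc_0 eqv_trans[OF eqv_sym[OF \<open>eqv F G\<close>]] by simp
  next
    case (asc_Suc N v F1 k)
    then show ?thesis
      using asc.asc_Suc[OF _ _ _ eqv_trans[OF eqv_sym[OF \<open>eqv F G\<close>]]] by simp
  qed
qed

lemma asc_up: "asc N v F \<Longrightarrow> k \<in> I \<Longrightarrow> pr k v < 0 \<Longrightarrow> asc (Suc N) (s k v) (act k F)"
  using asc_Suc eqv_refl by blast

text \<open>An exchange property: every descending reflection, not just the inverse of the last
  ascent, lowers \<open>N\<close> by exactly one. If \<open>k\<close> is adjacent to the last letter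
  \<open>l\<close>, the orbit of \<open>v\<close> under both reflections is a hexagon with
  \<open>v\<close> on top; the path goes down through \<open>w\<close> to the bottom and up the
  other side to \<open>s k v\<close>, and the braid relation identifies the functions.\<close>

lemma asc_down: "asc N v F \<Longrightarrow> k \<in> I \<Longrightarrow> pr k v > 0 \<Longrightarrow> \<exists>M. N = Suc M \<and> asc M (s k v) (act k F)"
proof (induction N arbitrary: v F k rule: less_induct)
  case (less N)
  from less.prems(1) show ?case
  proof (cases rule: asc.cases)
    case asc_0
    then show ?thesis using base_le less.prems by fastforce
  next
    case (asc_Suc N1 w F1 l)
    note w = asc_Suc
    have prl: "pr l v > 0" "s l v = w" using w pr_self s_s by auto
    show ?thesis
    proof (cases "k = l")
      case True
      have "eqv F1 (act k F)" using eqv_trans[OF act_cong[OF w(4) w(6)] act_act[OF w(4)]] True eqv_sym by simp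
      then show ?thesis using w True prl asc_eqv[OF w(3)] by simp
    next
      case kl: False
      show ?thesis
      proof (cases "adj k l")
        case False
        have "pr k w > 0" using pr_comm[of k l v] kl False w less.prems prl by simp
        then obtain M where M: "N1 = Suc M" "asc M (s k w) (act k F1)"
          using less.IH[of N1 w F1 k] w less.prems by auto
        have "pr l (s k w) < 0"
          using pr_comm[of l k w] kl False w less.prems adj_sym by metis
        then have "asc (Suc M) (s l (s k w)) (act l (act k F1))" using asc_up M w by blast
        moreover have "s l (s k w) = s k v" using s_comm[of l k w] kl False w less.prems adj_sym by metis
        moreover have "eqv (act l (act k F1)) (act k F)"
          using eqv_trans[OF act_comm[of l k F1] eqv_sym[OF act_cong[OF less.prems(2) w(6)]]]
            kl False adj_sym w(4) less.prems(2) by blast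
        ultimately show ?thesis using M w asc_eqv by metis
      next
        case True
        note adj = True adj_sym[OF True]
        have w1: "pr k w = pr k v + pr l v" using pr_adj[of k l v] adj w less.prems prl by simp
        then have "pr k w > 0" using prl less.prems by simp
        then obtain M where M: "N1 = Suc M" "asc M (s k w) (act k F1)"
          using less.IH[of N1 w F1 k] w less.prems by auto
        have w2: "pr l (s k w) = pr k v"
          using pr_adj[of l k w] adj w less.prems w1 pr_self prl by auto
        \<comment> \<open>The bottom of the hexagon, two further descents below
          \<open>w\<close>.\<close>
        then obtain L where L: "M = Suc L" "asc L (s l (s k w)) (act l (act k F1))"
          using less.IH[of M "s k w" "act k F1" l] w M less.prems by auto
        have w3: "pr k (s l (s k w)) = - pr l v"
          using pr_adj[of k l "s k w"] w2 pr_self[of k w] w1 adj w less.prems by simp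
        then have "asc (Suc L) (s k (s l (s k w))) (act k (act l (act k F1)))"
          using asc_up[OF L(2) less.prems(2)] prl by simp
        moreover have "s k (s l (s k w)) = s l (s k v)" using s_braid[of k l w] adj w less.prems prl s_s
          by metis
        moreover have "pr l (s l (s k v)) = - (pr l v + pr k v)"
          using pr_self pr_adj[of l k v] adj w less.prems by simp
        ultimately have "asc (Suc (Suc L)) (s l (s l (s k v))) (act l (act k (act l (act k F1))))"
          using asc_up w prl less.prems
          by (metis (no_types, lifting) neg_less_0_iff_less add_pos_pos)
        moreover have "s l (s l (s k v)) = s k v" using s_s w by blast
        moreover have "eqv (act l (act k (act l (act k F1)))) (act k F)"
        proof -
          have "eqv (act k (act l (act k F1))) (act l (act k (act l F1)))"
            using act_braid adj w less.prems by blast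
          then have "eqv (act l (act k (act l (act k F1)))) (act l (act l (act k (act l F1))))"
            using act_cong w by blast
          moreover have "eqv (act k (act l F1)) (act k F)" using act_cong w less.prems eqv_sym by blast
          ultimately show ?thesis using eqv_trans act_act[OF w(4)] by blast
        qed
        ultimately show ?thesis using M L w asc_eqv by metis
      qed
    qed
  qed
qed

text \<open>The last letter \<open>l\<close> differs from \<open>k\<close>. If they are adjacent,
  the action of \<open>s_k\<close> at \<open>v\<close> is conjugate to that of \<open>s_l\<close> at
  \<open>s k w\<close>, two steps lower, where the pairing with \<open>l\<close> vanishes;
  \<open>asc_down\<close> supplies this lower point and the braid relation brings invariance back
  up.\<close>

lemma asc_fix: "asc N v F \<Longrightarrow> k \<in> I \<Longrightarrow> pr k v = 0 \<Longrightarrow> eqv (act k F) F"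
proof (induction N arbitrary: v F k rule: less_induct)
  case (less N)
  from less.prems(1) show ?case
  proof (cases rule: asc.cases)
    case asc_0
    then show ?thesis 
      using eqv_trans[OF eqv_trans[OF act_cong base_fix] eqv_sym] less.prems by blast
  next
    case (asc_Suc N1 w F1 l)
    note w = asc_Suc
    have prl: "pr l v > 0" "s l v = w" using w pr_self s_s by auto
    then have kl: "k \<noteq> l" using less.prems by auto
    have kF: "eqv (act k F) (act k (act l F1))" using act_cong[OF less.prems(2) w(6)] .
    show ?thesis
    proof (cases "adj k l")
      case False
      have "pr k w = 0" using pr_comm[of k l v] kl False w less.prems prl by simp
      then have "eqv (act k F1) F1" using less.IH[of N1] w less.prems by blast
      then have 1: "eqv (act l (act k F1)) (act l F1)" using act_cong w by blast
      have "eqv (act k (act l F1)) (act l (act k F1))" using act_comm kl False w less.prems by blast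
      then show ?thesis using eqv_trans[OF kF eqv_trans[OF _ eqv_trans[OF 1 eqv_sym[OF w(6)]]]] by blast
    next
      case True
      note adj = True adj_sym[OF True]
      have w1: "pr k w = pr l v" using pr_adj[of k l v] adj w less.prems prl by simp
      then obtain M where M: "N1 = Suc M" "asc M (s k w) (act k F1)"
        using asc_down[of N1 w F1 k] w less.prems prl by auto
      have "pr l (s k w) = 0" using pr_adj[of l k w] adj w less.prems w1 pr_self prl by auto
      then have "eqv (act l (act k F1)) (act k F1)" using less.IH[of M] w M by auto
      then have "eqv (act k (act l (act k F1))) (act k (act k F1))" using act_cong less.prems by blast
      then have 1: "eqv (act k (act l (act k F1))) F1"
        using eqv_trans[OF _ act_act[OF less.prems(2)]] by blast
      have "eqv (act l (act k (act l F1))) F1"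
        using eqv_trans[OF eqv_sym[OF act_braid] 1] adj w less.prems by blast
      then have "eqv (act l (act l (act k (act l F1)))) (act l F1)" using act_cong w by blast
      then have "eqv (act k (act l F1)) (act l F1)" using eqv_trans[OF eqv_sym[OF act_act[OF w(4)]]] by blast
      then show ?thesis using eqv_trans[OF kF eqv_trans[OF _ eqv_sym[OF w(6)]]] by blast
    qed
  qed
qed

text \<open>The last ascent of one path is a descent at \<open>v\<close>, so \<open>asc_down\<close>
  removes it from the other path too.\<close>

lemma asc_unique: "asc N v F \<Longrightarrow> asc N' v G \<Longrightarrow> eqv F G"
proof (induction N arbitrary: v F N' G)
  case 0
  from 0(1) have v: "v = v0" "eqv F F0" by (auto elim: asc.cases)
  from 0(2) show ?case
  proof (cases rule: asc.cases)
    case asc_0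
    then show ?thesis using eqv_trans[OF v(2) eqv_sym] by blast
  next
    case (asc_Suc N1 w F1 l)
    then show ?thesis using v pr_self base_le[of l] by fastforce
  qed
next
  case (Suc N)
  from Suc.prems(1) obtain w F1 k where w: "v = s k w" "asc N w F1" "k \<in> I" "pr k w < 0" "eqv F (act k F1)"
    by (auto elim: asc.cases)
  then obtain M where M: "asc M (s k v) (act k G)"
    using asc_down[of N' v G k] Suc.prems pr_self by fastforce
  then have "eqv F1 (act k G)" using Suc.IH w s_s by metis
  then have "eqv (act k F1) G" using eqv_trans[OF act_cong act_act] w(3) by blast
  then show ?case using eqv_trans[OF w(5)] by blast
qed

text \<open>A letter of an arbitrary word climbs, fixes or descends according to the sign of its
  pairing; \<open>asc_fix\<close> and \<open>asc_down\<close> absorb the last two cases.\<close>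

lemma asc_word: "set ws \<subseteq> I \<Longrightarrow> \<exists>N. asc N (foldr s ws v0) (foldr act ws F0)"
proof (induction ws)
  case Nil
  then show ?case using asc_0 eqv_refl by auto
next
  case (Cons k ws)
  then obtain N where N: "asc N (foldr s ws v0) (foldr act ws F0)" and k: "k \<in> I" by auto
  let ?v = "foldr s ws v0" and ?F = "foldr act ws F0"
  consider "pr k ?v < 0" | "pr k ?v = 0" | "pr k ?v > 0" by linarith
  then show ?case
  proof cases
    case 1
    then show ?thesis using asc_up[OF N k] by auto
  next
    case 2
    then show ?thesis using asc_eqv[OF N eqv_sym[OF asc_fix[OF N k]]] s_fix[OF k] by auto
  next
    case 3
    then show ?thesis using asc_down[OF N k] by auto
  qed
qed

theorem word_unique:
  assumes "set ws \<subseteq> I" "set ws' \<subseteq> I" "foldr s ws v0 = foldr s ws' v0"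
  shows "eqv (foldr act ws F0) (foldr act ws' F0)"
  using asc_word[OF assms(1)] asc_word[OF assms(2)] assms(3) asc_unique by metis

end

subsection \<open>The reflection representation\<close>

type_synonym point = "(nat \<Rightarrow> complex) \<times> (nat \<Rightarrow> complex) \<times> (nat \<Rightarrow> complex)"

lemma transp_simps [simp]:
  "transp k k = Suc k" "transp k (Suc k) = k" "transp k (transp k i) = i"
  "i < k \<Longrightarrow> transp k i = i" "Suc k < i \<Longrightarrow> transp k i = i"
  by (auto simp: transp_def)

lemma transp_comm: "Suc k < l \<or> Suc l < k \<Longrightarrow> transp k (transp l i) = transp l (transp k i)"
  by (auto simp: transp_def)

lemma transp_braid: "transp k (transp (Suc k) (transp k i)) = transp (Suc k) (transp k (transp (Suc k) i))"
  by (auto simp: transp_def)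

text \<open>The pairing \<langle>h_0, a\<rangle>, with the sum cut down to the support of
  \<open>h_0\<close>. Polymorphism in the ring lets one computation serve integral lattice vectors
  and complex points of the Cartan space.\<close>

definition pair0 :: "nat \<Rightarrow> (nat \<Rightarrow> 'a::comm_ring_1) \<Rightarrow> 'a" where
  "pair0 m a = - (of_nat m - 2) * a 0 - (\<Sum>t=1..m. a t)"

definition root_pair :: "nat \<Rightarrow> nat \<Rightarrow> (nat \<Rightarrow> 'a::comm_ring_1) \<Rightarrow> 'a" where
  "root_pair m k a = (if k = 0 then pair0 m a else a k - a (Suc k))"

definition root_refl :: "nat \<Rightarrow> nat \<Rightarrow> (nat \<Rightarrow> 'a::comm_ring_1) \<Rightarrow> nat \<Rightarrow> 'a" where
  "root_refl m k a = (if k = 0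
     then (\<lambda>t. if t = 0 then a t - pair0 m a else if t \<le> m then a t + pair0 m a else a t)
     else a \<circ> transp k)"

definition adjacent :: "nat \<Rightarrow> nat \<Rightarrow> nat \<Rightarrow> bool" where
  "adjacent m k l \<longleftrightarrow> k = 0 \<and> l = m \<or> k = m \<and> l = 0 \<or> 0 < k \<and> 0 < l \<and> (k = Suc l \<or> l = Suc k)"

lemma pair0_transp:
  assumes "0 < k"
  shows "pair0 m (a \<circ> transp k) = (if k = m then pair0 m a + a m - a (Suc m) else pair0 m a)"
proof -
  consider "m < k" | "k = m" | "k < m" by linarith
  then show ?thesis
  proof cases
    case 1
    then have "(\<Sum>t=1..m. a (transp k t)) = (\<Sum>t=1..m. a t)"
      by (intro sum.cong) (auto simp: transp_def)
    then show ?thesis using 1 assms by (simp add: pair0_def)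
  next
    case 2
    obtain m' where m': "m = Suc m'" using 2 assms by (cases m) auto
    have "(\<Sum>t=1..m'. a (transp m t)) = (\<Sum>t=1..m'. a t)"
      by (intro sum.cong) (auto simp: m' transp_def)
    then show ?thesis using 2 m' by (simp add: pair0_def)
  next
    case 3
    have "(\<Sum>t=1..m. a (transp k t)) = (\<Sum>t=1..m. a t)"
      by (rule sum.reindex_bij_witness[of _ "transp k" "transp k"])
        (use 3 assms in \<open>auto simp: transp_def\<close>)
    then show ?thesis using 3 assms by (simp add: pair0_def)
  qed
qed

text \<open>Rests on \<langle>h_0, h_0\<rangle> = -(m-2) + m = 2.\<close>

lemma pair0_refl0: "pair0 m (root_refl m 0 a) = - pair0 m a"
proof -
  have "(\<Sum>t=1..m. root_refl m 0 a t) = (\<Sum>t=1..m. a t) + of_nat m * pair0 m a"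
    by (simp add: root_refl_def sum.distrib)
  then have "pair0 m (root_refl m 0 a) =
     - (of_nat m - 2) * (a 0 - pair0 m a) - ((\<Sum>t=1..m. a t) + of_nat m * pair0 m a)"
    by (simp add: pair0_def[of m "root_refl m 0 a"]) (simp add: root_refl_def)
  also have "\<dots> = - pair0 m a" by (simp add: pair0_def algebra_simps)
  finally show ?thesis .
qed

lemma root_refl_transp: "0 < k \<Longrightarrow> root_refl m k a = a \<circ> transp k"
  by (simp add: root_refl_def)

lemma root_refl_0:
  "root_refl m 0 a t = (if t = 0 then a t - pair0 m a else if t \<le> m then a t + pair0 m a else a t)"
  by (simp add: root_refl_def)

lemma root_pair_refl_self: "root_pair m k (root_refl m k a) = - root_pair m k a"
  by (cases "k = 0") (simp_all add: root_pair_def pair0_refl0 root_refl_transp)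

lemma root_pair_refl_comm:
  assumes "k \<noteq> l" "\<not> adjacent m k l" "0 < m"
  shows "root_pair m k (root_refl m l a) = root_pair m k a"
proof (cases "k = 0")
  case True
  then show ?thesis using assms by (simp add: root_pair_def adjacent_def root_refl_transp pair0_transp)
next
  case False
  then show ?thesis using assms
    by (cases "l = 0") (auto simp: root_pair_def adjacent_def root_refl_0 root_refl_transp transp_def)
qed

lemma root_pair_refl_adj:
  assumes "adjacent m k l" "0 < m"
  shows "root_pair m k (root_refl m l a) = root_pair m k a + root_pair m l a"
proof (cases "k = 0")
  case True
  then show ?thesis using assms
    by (auto simp: root_pair_def adjacent_def root_refl_transp pair0_transp)
next
  case False
  then show ?thesis using assms
    by (cases "l = 0") (auto simp: root_pair_def adjacent_def root_refl_0 root_refl_transp)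
qed

lemma root_refl_refl: "root_refl m k (root_refl m k a) = a"
proof (cases "k = 0")
  case True
  then show ?thesis using pair0_refl0[of m a]
    by (intro ext) (simp add: root_refl_0)
qed (simp add: root_refl_transp fun_eq_iff)

lemma root_refl_fix: "root_pair m k a = 0 \<Longrightarrow> root_refl m k a = a"
  by (cases "k = 0") (auto simp: root_refl_def root_pair_def transp_def fun_eq_iff)

lemma root_refl0_transp:
  assumes "0 < k" "k \<noteq> m"
  shows "root_refl m 0 (a \<circ> transp k) = root_refl m 0 a \<circ> transp k"
  using assms by (auto simp: fun_eq_iff root_refl_0 pair0_transp transp_def)

lemma root_refl_comm:
  assumes "k \<noteq> l" "\<not> adjacent m k l"
  shows "root_refl m k (root_refl m l a) = root_refl m l (root_refl m k a)"
proof -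
  consider "k = 0" "0 < l" "l \<noteq> m" | "l = 0" "0 < k" "k \<noteq> m"
    | "0 < k" "0 < l" "Suc k < l \<or> Suc l < k"
    using assms unfolding adjacent_def by (metis Suc_lessI gr0I linorder_neqE_nat)
  then show ?thesis
    by cases (auto simp: root_refl_transp root_refl0_transp fun_eq_iff transp_comm)
qed

lemma root_refl_braid0:
  assumes "0 < m"
  shows "root_refl m 0 (root_refl m m (root_refl m 0 a)) = root_refl m m (root_refl m 0 (root_refl m m a))"
proof
  fix t
  have 1: "pair0 m (root_refl m m (root_refl m 0 a)) = a m - a (Suc m)"
    using assms by (simp add: root_refl_transp pair0_transp pair0_refl0) (simp add: root_refl_0)
  have 2: "pair0 m (root_refl m m a) = pair0 m a + a m - a (Suc m)"
    using assms by (simp add: root_refl_transp pair0_transp)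
  show "root_refl m 0 (root_refl m m (root_refl m 0 a)) t = root_refl m m (root_refl m 0 (root_refl m m a)) t"
    using assms by (auto simp: root_refl_0[of m "root_refl m m _"] 1 2)
      (auto simp: root_refl_0 root_refl_transp transp_def pair0_transp)
qed

lemma root_refl_braid:
  assumes "adjacent m k l" "0 < m"
  shows "root_refl m k (root_refl m l (root_refl m k a)) = root_refl m l (root_refl m k (root_refl m l a))"
proof -
  consider "k = 0" "l = m" | "k = m" "l = 0" | "0 < k" "l = Suc k" | "0 < l" "k = Suc l"
    using assms by (auto simp: adjacent_def)
  then show ?thesis
    
  proof cases
    case 1
    then show ?thesis using root_refl_braid0 assms by simp
  next
    case 2
    then show ?thesis by (simp add: root_refl_braid0[OF assms(2)])
  qed (auto simp: root_refl_transp fun_eq_iff transp_braid)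
qed

section \<open>Comparison with the given form, roots and reflections\<close>

lemma lform_hvec:
  assumes "k < n" "m < n"
  shows "lform m n (hvec m k) a = root_pair m k a"
proof (cases "k = 0")
  case True
  have "(\<Sum>t=1..n. hvec m 0 t * a t) = (\<Sum>t=1..n. if t \<in> {1..m} then - a t else 0)"
    by (intro sum.cong) (auto simp: hvec_def evec_def)
  also have "\<dots> = (\<Sum>t=1..m. - a t)"
    using assms by (subst sum.inter_restrict[symmetric]) (auto intro!: sum.cong)
  finally show ?thesis using True
    by (simp add: lform_def root_pair_def pair0_def sum_negf) (simp add: hvec_def evec_def)
next
  case False
  have "(\<Sum>t=1..n. hvec m k t * a t) = (\<Sum>t=1..n. (if t = k then a t else 0) - (if t = Suc k then a t else 0))"
    using False by (intro sum.cong) (auto simp: hvec_def evec_def)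
  also have "\<dots> = a k - a (Suc k)"
    using False assms by (simp add: sum_subtractf)
  finally show ?thesis using False
    by (simp add: lform_def root_pair_def) (simp add: hvec_def evec_def)
qed

lemma alpha_eq:
  assumes "k < n" "m < n"
  shows "alpha m n k h = root_pair m k h"
proof (cases "k = 0")
  case True
  have "(\<Sum>t=1..n. of_int (hvec m 0 t) * h t) = (\<Sum>t=1..n. if t \<in> {1..m} then - h t else 0)"
    by (intro sum.cong) (auto simp: hvec_def evec_def)
  also have "\<dots> = (\<Sum>t=1..m. - h t)"
    using assms by (subst sum.inter_restrict[symmetric]) (auto intro!: sum.cong)
  finally show ?thesis using True
    by (simp add: alpha_def cform_def root_pair_def pair0_def sum_negf) (simp add: hvec_def evec_def)
next
  case False
  have "(\<Sum>t=1..n. of_int (hvec m k t) * h t) = (\<Sum>t=1..n. (if t = k then h t else 0) - (if t = Suc k then h t else 0))"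
    using False by (intro sum.cong) (auto simp: hvec_def evec_def)
  also have "\<dots> = h k - h (Suc k)"
    using False assms by (simp add: sum_subtractf)
  finally show ?thesis using False
    by (simp add: alpha_def cform_def root_pair_def) (simp add: hvec_def evec_def)
qed

lemma lrefl_eq:
  assumes "k < n" "m < n"
  shows "lrefl m n k a = root_refl m k a"
  using assms
  by (simp add: fun_eq_iff lrefl_def lform_hvec root_pair_def root_refl_def)
    (auto simp: hvec_def evec_def transp_def)

lemma hrefl_eq:
  assumes "k < n" "m < n"
  shows "hrefl m n k h = root_refl m k h"
  using assms
  by (simp add: fun_eq_iff hrefl_def alpha_eq root_pair_def root_refl_def)
    (auto simp: hvec_def evec_def transp_def)

lemma eps_eq: "1 \<le> j \<Longrightarrow> j \<le> n \<Longrightarrow> eps m n j h = h j"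
  by (simp add: eps_def cform_def evec_def if_distrib[of of_int] if_distrib[of "\<lambda>x. x * _"] cong: if_cong)

lemma eps_0: "eps m n 0 h = - (of_nat m - 2) * h 0"
  by (simp add: eps_def cform_def evec_def)

lemma pair0_upd: "pair0 m (h(j := z)) = pair0 m (h(j := 0)) - z" if "1 \<le> j" "j \<le> m" for h :: "nat \<Rightarrow> complex"
proof -
  have "(\<Sum>t=1..m. (h(j := w)) t) = w + (\<Sum>t\<in>{1..m} - {j}. h t)" for w
    using that by (subst sum.remove[of _ j]) (auto intro!: sum.cong)
  then show ?thesis using that by (simp add: pair0_def)
qed

lemma pair0_upd_big: "pair0 m (h(Suc m := z)) = pair0 m h" for h :: "nat \<Rightarrow> complex"
  by (simp add: pair0_def)

section \<open>Continuity and generic nonvanishing of the coordinates\<close>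

lemma continuous_on_h: "continuous_on S (\<lambda>p::point. fst p t)"
  by (rule continuous_on_product_then_coordinatewise[OF continuous_on_fst[OF continuous_on_id]])

lemma continuous_on_u: "continuous_on S (\<lambda>p::point. fst (snd p) t)"
  by (rule continuous_on_product_then_coordinatewise[OF continuous_on_fst[OF continuous_on_snd[OF continuous_on_id]]])

lemma continuous_on_y: "continuous_on S (\<lambda>p::point. snd (snd p) t)"
  by (rule continuous_on_product_then_coordinatewise[OF continuous_on_snd[OF continuous_on_snd[OF continuous_on_id]]])

lemma generic_nonzero: "generic (\<lambda>z::complex. z \<noteq> 0)"
  using generic_nonzero_holomorphic[of "\<lambda>z. z"] by (auto intro: exI[of _ 1])

lemma generic_u: "generic (\<lambda>p::point. fst (snd p) j \<noteq> 0)"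
proof (rule generic_section[OF generic_nonzero continuous_on_u])
  fix p :: point
  obtain h u y where p: "p = (h, u, y)" by (cases p)
  have "continuous_on UNIV (\<lambda>z. (h, u(j := z), y))"
    by (intro continuous_on_Pair continuous_fun_upd) (auto intro: continuous_intros)
  then show "\<exists>\<gamma>. continuous_on UNIV \<gamma> \<and> \<gamma> (fst (snd p) j) = p \<and> (\<forall>z. fst (snd (\<gamma> z)) j = z)"
    by (intro exI[of _ "\<lambda>z. (h, u(j := z), y)"]) (auto simp: p)
qed

lemma generic_y: "generic (\<lambda>p::point. snd (snd p) j \<noteq> 0)"
proof (rule generic_section[OF generic_nonzero continuous_on_y])
  fix p :: point
  obtain h u y where p: "p = (h, u, y)" by (cases p)
  have "continuous_on UNIV (\<lambda>z. (h, u, y(j := z)))"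
    by (intro continuous_on_Pair continuous_fun_upd) (auto intro: continuous_intros)
  then show "\<exists>\<gamma>. continuous_on UNIV \<gamma> \<and> \<gamma> (snd (snd p) j) = p \<and> (\<forall>z. snd (snd (\<gamma> z)) j = z)"
    by (intro exI[of _ "\<lambda>z. (h, u, y(j := z))"]) (auto simp: p)
qed

subsection \<open>The birational action\<close>

locale tau_system =
  fixes br :: "complex \<Rightarrow> complex" and m n :: nat
  assumes br_holo: "br holomorphic_on UNIV"
    and br_odd: "br (- z) = - br z"
    and br_nz: "\<exists>z. br z \<noteq> 0"
    and br_rel: "br (x+y) * br (x-y) * br (u+v) * br (u-v)
                   = br (x+u) * br (x-u) * br (y+v) * br (y-v)
                   - br (x+v) * br (x-v) * br (y+u) * br (y-u)"
    and m_ge: "3 \<le> m" and m_less: "m < n"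
begin

text \<open>The image of \<open>u_i\<close> under \<open>s_m\<close>, with \<open>a\<close> the value of \<open>\<alpha>_0\<close> and \<open>p = m\<close>, \<open>q = m + 1\<close>.\<close>

definition cross :: "complex \<Rightarrow> complex \<Rightarrow> complex \<Rightarrow> complex \<Rightarrow>
    complex \<Rightarrow> complex \<Rightarrow> complex \<Rightarrow> complex \<Rightarrow> complex \<Rightarrow> complex" where
  "cross a hi hp hq ui up yi yp yq =
    (br (a + hp - hq) * br (hi - hq) * yp * ui - br (a + hi - hq) * br (hp - hq) * yi * up)
      / (yq * br a * br (hi - hp))"

section \<open>Identities for the fraction \<open>cross\<close>\<close>

lemma br_diff_swap: "br (b - a) = - br (a - b)"
  using br_odd[of "a - b"] by simp

text \<open>The lattice vector behind the fraction does not distinguish \<open>i\<close> from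
  \<open>p\<close>. Numerator and denominator both change sign.\<close>

lemma cross_swap: "cross a hi hp hq ui up yi yp yq = cross a hp hi hq up ui yp yi yq"
  unfolding cross_def br_diff_swap[of hi hp] by (simp add: divide_simps)

text \<open>Expresses \<open>s_m^2 = 1\<close> on \<open>u_i\<close>: after one step the value of
  \<open>\<alpha>_0\<close> is \<open>a + hp - hq\<close>, and \<open>p\<close> and \<open>q\<close>
  have changed places.\<close>

lemma cross_inverse:
  assumes "br (a + hp - hq) \<noteq> 0" "br (hi - hq) \<noteq> 0" "br a \<noteq> 0" "br (hi - hp) \<noteq> 0" "yp \<noteq> 0" "yq \<noteq> 0"
  shows "cross (a + hp - hq) hi hq hp (cross a hi hp hq ui up yi yp yq) up yi yq yp = ui"
proof -
  have e: "a + hp - hq + hq - hp = a" "a + hp - hq + hi - hp = a + hi - hq" by simp_all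
  show ?thesis using assms
    unfolding cross_def e br_diff_swap[of hq hp] by (simp add: divide_simps)
qed

text \<open>The vector behind the fraction pairs with \<open>h_0\<close> to -(m-2) + (m-2) = 0, so
  its tau-function has to be fixed by \<open>s_0\<close>, which negates \<open>a\<close>, adds
  \<open>a\<close> to \<open>hi\<close> and \<open>hp\<close>, and exchanges \<open>u\<close> with
  \<open>y\<close>.\<close>

lemma cross_reflect0:
  "cross (- a) (hi + a) (hp + a) hq yi yp ui up yq = cross a hi hp hq ui up yi yp yq"
proof -
  have e: "- a + (hp + a) - hq = hp - hq" "- a + (hi + a) - hq = hi - hq"
      "hi + a - hq = a + hi - hq" "hp + a - hq = a + hp - hq" "hi + a - (hp + a) = hi - hp" by simp_all
  show ?thesis
    unfolding cross_def e br_odd by (simp add: divide_simps)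
qed

text \<open>The two terms in \<open>up\<close> carry the same factors
  \<open>br (a + hi - hq)\<close>, \<open>br (a + hr - hq)\<close>, \<open>br (hp - hq)\<close> with
  opposite signs and cancel; the rest has the common factor \<open>yp * br (a + hp - hq)\<close>,
  which cancels with the denominator.\<close>

lemma cross_braid_left:
  assumes "br (a + hp - hq) \<noteq> 0" "br (hi - hp) \<noteq> 0" "br (hr - hp) \<noteq> 0" "yp \<noteq> 0"
  shows "cross (a + hp - hq) hi hr hp (cross a hi hp hq ui up yi yp yq) (cross a hr hp hq ur up yr yp yq)
      yi yr yp = cross a hi hr hq ui ur yi yr yq"
proof -
  have e: "a + hp - hq + hr - hp = a + hr - hq" "a + hp - hq + hi - hp = a + hi - hq" by simp_all
  show ?thesis using assms
    unfolding cross_def e by (simp add: divide_simps) (simp add: algebra_simps)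
qed

lemma three_term:
  "br (a + hp - hr) * br (hi - hr) * br (a + hi - hq) * br (hp - hq)
   + br (a + hp - hq + hi - hr) * br (hq - hr) * br a * br (hi - hp)
   = br (a + hi - hr) * br (hp - hr) * br (a + hp - hq) * br (hi - hq)"
proof -
  \<comment> \<open>Solution of the linear system \<open>x - y = a\<close>,
    \<open>x + y = a + hp - hq + hi - hr\<close>, \<open>u + v = hq - hr\<close>,
    \<open>u - v = hi - hp\<close>; the other eight arguments in \<open>br_rel\<close> then come out
    as required.\<close>
  define x y u v where "x = a + (hp + hi - hq - hr) / 2" "y = (hp + hi - hq - hr) / 2"
    "u = (hi - hp + hq - hr) / 2" "v = (hq - hr - hi + hp) / 2"
  have e: "x + y = a + hp - hq + hi - hr" "x - y = a" "u + v = hq - hr" "u - v = hi - hp"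
    "x + u = a + hi - hr" "x - u = a + hp - hq" "y + v = hp - hr" "y - v = hi - hq"
    "x + v = a + hp - hr" "x - v = a + hi - hq" "y + u = hi - hr" "y - u = hp - hq"
    unfolding x_y_u_v_def by (simp_all add: field_simps)
  show ?thesis using br_rel[of x y u v] unfolding e by (simp add: algebra_simps)
qed

text \<open>After substitution the coefficient of \<open>up\<close> is a sum of two products.
  \<open>three_term\<close> merges them into one containing
  \<open>br (a + hp - hq) * br (hi - hq)\<close>, which cancels with the denominator.\<close>

lemma cross_braid_right:
  assumes "br (a + hp - hq) \<noteq> 0" "br (hi - hq) \<noteq> 0" "br a \<noteq> 0" "br (hi - hp) \<noteq> 0" "yq \<noteq> 0"
  shows "cross (a + hp - hq) hi hq hr (cross a hi hp hq ui up yi yp yq) up yi yq yr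
    = cross a hi hp hr ui up yi yp yr"
\<comment> \<open>For \<open>yr = 0\<close> both sides are quotients by 0 and have the value
  0.\<close>
proof (cases "yr = 0")
  case False
  have e: "a + hp - hq + hq - hr = a + hp - hr" by simp
  have "cross (a + hp - hq) hi hq hr (cross a hi hp hq ui up yi yp yq) up yi yq yr =
    (br (a + hp - hr) * br (hi - hr) * br (a + hp - hq) * br (hi - hq) * yp * ui
     - (br (a + hp - hr) * br (hi - hr) * br (a + hi - hq) * br (hp - hq)
        + br (a + hp - hq + hi - hr) * br (hq - hr) * br a * br (hi - hp)) * yi * up)
    / (yr * br a * br (hi - hp) * br (a + hp - hq) * br (hi - hq))"
    unfolding cross_def e using assms False by (simp add: divide_simps) (simp add: algebra_simps)
  also have "\<dots> = cross a hi hp hr ui up yi yp yr"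
    unfolding three_term cross_def using assms False
    by (simp add: divide_simps) (simp add: algebra_simps)
  finally show ?thesis .
qed (simp add: cross_def)

text \<open>Points are triples \<open>(h, u, y)\<close> with \<open>y_j\<close> the value of \<open>\<tau>_j\<close>.\<close>

definition cstep :: "nat \<Rightarrow> point \<Rightarrow> point" where
  "cstep k p = (let h = fst p; u = fst (snd p); y = snd (snd p) in
    (root_refl m k h,
     (\<lambda>i. if i < 1 \<or> m < i then u i else if k = 0 then y i else if k < m then u (transp k i)
          else if k = m \<and> i \<noteq> m
          then cross (pair0 m h) (h i) (h m) (h (Suc m)) (u i) (u m) (y i) (y m) (y (Suc m))
          else u i),
     (if k = 0 then (\<lambda>j. if 1 \<le> j \<and> j \<le> m then u j else y j) else y \<circ> transp k)))"

text \<open>Excludes the poles of \<open>s_m\<close> at the point and also at its image: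
  \<open>pair0 m h + h m - h (Suc m)\<close> is the value of \<alpha>_0 after \<open>s_m\<close>,
  which also swaps the coordinates \<open>m\<close> and \<open>m + 1\<close> of \<open>h\<close> and
  \<open>y\<close>. Hence the set is stable under \<open>cstep m\<close>.\<close>

definition regular :: "point \<Rightarrow> bool" where
  "regular p \<longleftrightarrow> (let h = fst p; y = snd (snd p) in
     br (pair0 m h) \<noteq> 0 \<and> br (pair0 m h + h m - h (Suc m)) \<noteq> 0
     \<and> (\<forall>i\<in>{1..<m}. br (h i - h m) \<noteq> 0 \<and> br (h i - h (Suc m)) \<noteq> 0) \<and> y m \<noteq> 0 \<and> y (Suc m) \<noteq> 0)"

section \<open>Coxeter relations on points\<close>

lemma pair0_root_refl_m: "pair0 m (root_refl m m a) = pair0 m a + a m - a (Suc m)"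
  using m_ge by (simp add: root_refl_transp pair0_transp)

lemma root_refl_m: "root_refl m m a = a \<circ> transp m"
  using m_ge by (simp add: root_refl_transp)

lemma cstep_cstep:
  assumes "k = m \<Longrightarrow> regular p"
  shows "cstep k (cstep k p) = p"
proof -
  obtain h u y where p: "p = (h, u, y)" by (cases p)
  consider "k = 0" | "0 < k" "k \<noteq> m" | "k = m" by blast
  then show ?thesis
  proof cases
    case 1
    then show ?thesis by (auto simp: p cstep_def Let_def fun_eq_iff root_refl_refl)
  next
    case 2
    then show ?thesis
      by (auto simp: p cstep_def Let_def fun_eq_iff root_refl_refl) (auto simp: transp_def split: if_splits)
  next
    case 3
    then show ?thesis using assms m_ge
      by (auto simp: p cstep_def Let_def fun_eq_iff root_refl_refl pair0_root_refl_m)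
        (simp add: root_refl_m cross_inverse regular_def Let_def)
  qed
qed

lemma cstep_comm:
  assumes "k \<noteq> l" "\<not> adjacent m k l"
  shows "cstep k (cstep l p) = cstep l (cstep k p)"
proof -
  obtain h u y where p: "p = (h, u, y)" by (cases p)
  have *: "cstep k (cstep l p) = cstep l (cstep k p)" if kl: "k < l" "\<not> adjacent m k l" for k l
  proof -
    have h: "root_refl m k (root_refl m l h) = root_refl m l (root_refl m k h)"
      using kl by (intro root_refl_comm) auto
    consider "k = 0" "l \<noteq> m" "0 < l" | "0 < k" "Suc k < l" 
      using kl unfolding adjacent_def by linarith
    then show ?thesis
    proof cases
      case 1
      then show ?thesis using h
        by (auto simp: p cstep_def Let_def fun_eq_iff transp_def split: if_splits)
    next
      case 2
      consider "l < m" | "l = m" | "k = m" | "m < l" "k \<noteq> m" by linarith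
      then show ?thesis
      proof cases
        case 2
        then show ?thesis using h \<open>0 < k\<close> \<open>Suc k < l\<close>
          by (auto simp: p cstep_def Let_def fun_eq_iff transp_comm root_refl_transp pair0_transp)
            (auto simp: transp_def split: if_splits)
      next
        case 3
        then show ?thesis using h \<open>0 < k\<close> \<open>Suc k < l\<close>
          by (auto simp: p cstep_def Let_def fun_eq_iff transp_comm root_refl_transp pair0_transp)
      qed (use 2 h in \<open>auto simp: p cstep_def Let_def fun_eq_iff transp_comm\<close>,
          auto simp: transp_def split: if_splits)
    qed
  qed
  have "adjacent m l k = adjacent m k l" by (auto simp: adjacent_def)
  then show ?thesis using *[of k l] *[of l k] assms by (metis linorder_neqE_nat)
qed

text \<open>Invariance of the fraction under \<open>s_0\<close> strips \<open>s_0\<close> from both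
  sides. In the \<open>u\<close> coordinates below \<open>m\<close> this leaves
  \<open>s_m^2 = 1\<close>; in the \<open>y\<close> coordinates below \<open>m\<close> both sides
  become the same single fraction.\<close>

lemma cstep_braid0:
  assumes "regular p"
  shows "cstep 0 (cstep m (cstep 0 p)) = cstep m (cstep 0 (cstep m p))"
proof -
  obtain h u y where p: "p = (h, u, y)" by (cases p)
  have h: "root_refl m 0 (root_refl m m (root_refl m 0 h)) = root_refl m m (root_refl m 0 (root_refl m m h))"
    using m_ge by (intro root_refl_braid0) auto
  define h1 where "h1 = root_refl m 0 h"
  define h2 where "h2 = root_refl m 0 (root_refl m m h)"
  have inv: "cross (pair0 m h2) (h2 i) (h2 m) (h2 (Suc m)) (y i) (y (Suc m))
     (cross (pair0 m h) (h i) (h m) (h (Suc m)) (u i) (u m) (y i) (y m) (y (Suc m))) (u m) (y m) = u i"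
    if "1 \<le> i" "i < m" for i
  proof -
    define a where "a = pair0 m h + h m - h (Suc m)"
    have "pair0 m h2 = - a" "h2 i = h i + a" "h2 m = h (Suc m) + a" "h2 (Suc m) = h m"
      using that by (simp_all add: h2_def a_def pair0_refl0 root_refl_0 pair0_root_refl_m)
        (simp_all add: root_refl_m)
    moreover have "cross a (h i) (h (Suc m)) (h m)
       (cross (pair0 m h) (h i) (h m) (h (Suc m)) (u i) (u m) (y i) (y m) (y (Suc m))) (u m)
       (y i) (y (Suc m)) (y m) = u i"
      unfolding a_def using assms that by (intro cross_inverse) (auto simp: p regular_def Let_def)
    ultimately show ?thesis by (simp only: cross_reflect0)
  qed
  have inv': "cross (pair0 m h1) (h1 i) (h1 m) (h1 (Suc m)) (y i) (y m) (u i) (u m) (y (Suc m))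
      = cross (pair0 m h) (h i) (h m) (h (Suc m)) (u i) (u m) (y i) (y m) (y (Suc m))"
    if "1 \<le> i" "i < m" for i
  proof -
    have "pair0 m h1 = - pair0 m h" "h1 i = h i + pair0 m h" "h1 m = h m + pair0 m h" "h1 (Suc m) = h (Suc m)"
      using that by (simp_all add: h1_def pair0_refl0 root_refl_0)
    then show ?thesis by (simp only: cross_reflect0)
  qed
  have c: "i < 1 \<or> i = Suc m \<or> Suc m < i \<or> i = m \<or> (1 \<le> i \<and> i < m)" for i
    by linarith
  show ?thesis
    unfolding p cstep_def Let_def fst_conv snd_conv h prod.inject using m_ge
    apply (intro conjI ext)
      apply simp
    subgoal for i
      using c[of i] by (elim disjE) (simp_all add: inv flip: h1_def h2_def)
    subgoal for i
      using c[of i] by (elim disjE) (simp_all add: inv' flip: h1_def h2_def)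
    done
qed

text \<open>The \<open>u\<close> coordinates split: \<open>i < r\<close> is
  \<open>cross_braid_left\<close>, \<open>i = m\<close> is the symmetry of the fraction, and
  \<open>i = r\<close> is its inversion combined with that symmetry.\<close>

lemma cstep_braid_left:
  assumes "regular p" "m = Suc r"
  shows "cstep r (cstep m (cstep r p)) = cstep m (cstep r (cstep m p))"
proof -
  obtain h u y where p: "p = (h, u, y)" by (cases p)
  have r: "0 < r" "r \<noteq> 0" "r < m" using m_ge assms by auto
  have h: "root_refl m r (root_refl m m (root_refl m r h)) = root_refl m m (root_refl m r (root_refl m m h))"
    using r assms by (intro root_refl_braid) (auto simp: adjacent_def)
  have P: "pair0 m (a \<circ> transp r) = pair0 m a"
    "pair0 m (a \<circ> transp m) = pair0 m a + a m - a (Suc m)" for a :: "nat \<Rightarrow> complex"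
    using r by (simp_all add: pair0_transp)
  have R: "root_refl m r a = a \<circ> transp r" for a :: "nat \<Rightarrow> complex"
    using r by (simp add: root_refl_transp)
  have t: "transp r m = r" "transp r r = m" "transp m r = r" "\<And>i. i < r \<Longrightarrow> transp r i = i"
     "\<And>i. i < m \<Longrightarrow> transp m i = i" "transp r (Suc m) = Suc m"
    using assms by (auto simp: transp_def)
  have inv: "cross (pair0 m h + h m - h (Suc m)) (h r) (h (Suc m)) (h m)
      (cross (pair0 m h) (h r) (h m) (h (Suc m)) (u r) (u m) (y r) (y m) (y (Suc m))) (u m)
       (y r) (y (Suc m)) (y m) = u r"
    using assms(1) r by (intro cross_inverse) (auto simp: p regular_def Let_def)
  have inv': "cross (pair0 m h + h m - h (Suc m)) (h (Suc m)) (h r) (h m) (u m)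
      (cross (pair0 m h) (h r) (h m) (h (Suc m)) (u r) (u m) (y r) (y m) (y (Suc m))) 
       (y (Suc m)) (y r) (y m) = u r"
    using inv by (subst cross_swap)
  have bl: "cross (pair0 m h + h m - h (Suc m)) (h i) (h r) (h m)
      (cross (pair0 m h) (h i) (h m) (h (Suc m)) (u i) (u m) (y i) (y m) (y (Suc m)))
      (cross (pair0 m h) (h r) (h m) (h (Suc m)) (u r) (u m) (y r) (y m) (y (Suc m)))
      (y i) (y r) (y m)
    = cross (pair0 m h) (h i) (h r) (h (Suc m)) (u i) (u r) (y i) (y r) (y (Suc m))"
    if "1 \<le> i" "i < r" for i
    using assms(1) r that by (intro cross_braid_left) (auto simp: p regular_def Let_def)
  have sw: "cross (pair0 m h) (h m) (h r) (h (Suc m)) (u m) (u r) (y m) (y r) (y (Suc m))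
     = cross (pair0 m h) (h r) (h m) (h (Suc m)) (u r) (u m) (y r) (y m) (y (Suc m))"
    by (rule cross_swap)
  have c: "i < 1 \<or> m < i \<or> i = m \<or> i = r \<or> (1 \<le> i \<and> i < r \<and> i < m)" for i
    using assms by linarith
  have y: "y (transp r (transp m (transp r i))) = y (transp m (transp r (transp m i)))" for i
    using transp_braid[of r i] assms by simp
  show ?thesis
    unfolding p cstep_def Let_def fst_conv snd_conv h prod.inject using r
    apply (intro conjI ext)
      apply simp
    subgoal for i
      using c[of i] r
      by (elim disjE) (simp_all add: P R root_refl_m t bl inv inv' sw flip: assms(2))
    subgoal for i using y by simp
    done
qed

lemma cstep_braid_right:
  assumes "regular p"
  shows "cstep (Suc m) (cstep m (cstep (Suc m) p)) = cstep m (cstep (Suc m) (cstep m p))"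
proof -
  obtain h u y where p: "p = (h, u, y)" by (cases p)
  have h: "root_refl m (Suc m) (root_refl m m (root_refl m (Suc m) h)) =
      root_refl m m (root_refl m (Suc m) (root_refl m m h))"
    using m_ge by (intro root_refl_braid) (auto simp: adjacent_def)
  have P: "pair0 m (a \<circ> transp (Suc m)) = pair0 m a"
    "pair0 m (a \<circ> transp m) = pair0 m a + a m - a (Suc m)" for a :: "nat \<Rightarrow> complex"
    using m_ge by (simp_all add: pair0_transp)
  have R: "root_refl m (Suc m) a = a \<circ> transp (Suc m)" for a :: "nat \<Rightarrow> complex"
    by (simp add: root_refl_transp)
  have br': "cross (pair0 m h + h m - h (Suc m)) (h i) (h (Suc m)) (h (Suc (Suc m)))
      (cross (pair0 m h) (h i) (h m) (h (Suc m)) (u i) (u m) (y i) (y m) (y (Suc m))) (u m)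
      (y i) (y (Suc m)) (y (Suc (Suc m)))
    = cross (pair0 m h) (h i) (h m) (h (Suc (Suc m))) (u i) (u m) (y i) (y m) (y (Suc (Suc m)))"
    if "1 \<le> i" "i < m" for i
    using assms that by (intro cross_braid_right) (auto simp: p regular_def Let_def)
  show ?thesis
    unfolding p cstep_def Let_def fst_conv snd_conv h prod.inject using m_ge
    apply (intro conjI ext)
      apply simp
    subgoal for i
      by (simp add: P R root_refl_m br')
    subgoal for i using transp_braid[of m i] by simp
    done
qed

lemma cstep_low:
  assumes "0 < k" "k < m"
  shows "cstep k (h, u, y) = (root_refl m k h, u \<circ> transp k, y \<circ> transp k)"
proof -
  have "transp k i = i" if "i < 1 \<or> m < i" for i using assms that by (auto simp: transp_def)
  then show ?thesis using assms by (auto simp: cstep_def fun_eq_iff)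
qed

lemma cstep_high: "m < k \<Longrightarrow> cstep k (h, u, y) = (root_refl m k h, u, y \<circ> transp k)"
  by (auto simp: cstep_def fun_eq_iff)

lemma cstep_braid:
  assumes "regular p" "adjacent m k l"
  shows "cstep k (cstep l (cstep k p)) = cstep l (cstep k (cstep l p))"
proof -
  have perm: "cstep k (cstep (Suc k) (cstep k p)) = cstep (Suc k) (cstep k (cstep (Suc k) p))"
    if k: "0 < k" "k \<noteq> m" "Suc k \<noteq> m" for k
  proof -
    obtain h u y where p: "p = (h, u, y)" by (cases p)
    have h: "root_refl m k (root_refl m (Suc k) (root_refl m k h)) =
        root_refl m (Suc k) (root_refl m k (root_refl m (Suc k) h))"
      using m_ge k by (intro root_refl_braid) (auto simp: adjacent_def)
    consider "Suc k < m" | "m < k" using k by linarith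
    then show ?thesis
    proof cases
      case 1
      then show ?thesis using k
        by (simp add: p cstep_low h) (simp add: fun_eq_iff transp_braid)
    next
      case 2
      then show ?thesis using k
        by (simp add: p cstep_high h) (simp add: fun_eq_iff transp_braid)
    qed
  qed
  have step: "cstep k (cstep (Suc k) (cstep k p)) = cstep (Suc k) (cstep k (cstep (Suc k) p))"
    if "0 < k" for k
    using perm[of k] cstep_braid_left[OF assms(1), of k] cstep_braid_right[OF assms(1)] that by metis
  consider "k = 0" "l = m" | "k = m" "l = 0" | "0 < k" "l = Suc k" | "0 < l" "k = Suc l"
    using assms by (auto simp: adjacent_def)
  then show ?thesis
  proof cases
    case 4
    then show ?thesis using step[of l] by simp
  qed (use step cstep_braid0[OF assms(1)] in auto)
qed

section \<open>Generic sets under the action on points\<close>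

lemma continuous_on_pair0: "continuous_on S (\<lambda>p::point. pair0 m (fst p))"
  unfolding pair0_def by (intro continuous_intros continuous_on_h)

lemma continuous_on_br:
  assumes "continuous_on S f"
  shows "continuous_on S (\<lambda>p. br (f p))"
  using continuous_on_compose2[OF holomorphic_on_imp_continuous_on[OF br_holo] assms] by simp

text \<open>Each linear form in \<open>regular\<close> has slope -1 in some coordinate
  \<open>j\<close>; solving \<open>\<phi> = z\<close> for that coordinate gives a continuous section
  through any point.\<close>

lemma generic_br:
  fixes \<phi> :: "point \<Rightarrow> complex"
  assumes c: "continuous_on UNIV \<phi>"
    and aff: "\<And>h u y z. \<phi> (h(j := z), u, y) = \<phi> (h(j := 0), u, y) - z"
  shows "generic (\<lambda>p. br (\<phi> p) \<noteq> 0)"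
proof (rule generic_section[OF generic_nonzero_holomorphic[OF br_holo br_nz] c])
  fix p :: point
  obtain h u y where p: "p = (h, u, y)" by (cases p)
  let ?\<gamma> = "\<lambda>z. (h(j := \<phi> (h(j := 0), u, y) - z), u, y)"
  have "\<phi> (h, u, y) = \<phi> (h(j := 0), u, y) - h j" using aff[of h "h j" u y] by simp
  then have "?\<gamma> (\<phi> p) = p" by (simp add: p)
  moreover have "\<phi> (?\<gamma> z) = z" for z by (subst aff) simp
  moreover have "continuous_on UNIV ?\<gamma>"
    by (intro continuous_on_Pair continuous_fun_upd) (auto intro: continuous_intros)
  ultimately show "\<exists>\<gamma>. continuous_on UNIV \<gamma> \<and> \<gamma> (\<phi> p) = p \<and> (\<forall>z. \<phi> (\<gamma> z) = z)" by blast
qed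

lemma generic_regular: "generic regular"
proof -
  have "generic (\<lambda>p::point. br (pair0 m (fst p)) \<noteq> 0)"
    by (rule generic_br[of "\<lambda>p::point. pair0 m (fst p)" 1]) (use m_ge in \<open>auto intro!: continuous_on_pair0 pair0_upd\<close>)
  moreover have "generic (\<lambda>p::point. br (pair0 m (fst p) + fst p m - fst p (Suc m)) \<noteq> 0)"
    by (rule generic_br[of "\<lambda>p::point. pair0 m (fst p) + fst p m - fst p (Suc m)" "Suc m"])
      (auto intro!: continuous_intros continuous_on_pair0 continuous_on_h simp: pair0_upd_big)
  moreover have "generic (\<lambda>p::point. \<forall>i\<in>{1..<m}. br (fst p i - fst p m) \<noteq> 0 \<and> br (fst p i - fst p (Suc m)) \<noteq> 0)"
    by (intro generic_ball generic_conj
        generic_br[of "\<lambda>p::point. fst p i - fst p m" m for i]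
        generic_br[of "\<lambda>p::point. fst p i - fst p (Suc m)" "Suc m" for i])
      (auto intro!: continuous_intros continuous_on_h)
  ultimately have "generic (\<lambda>p::point. br (pair0 m (fst p)) \<noteq> 0 \<and>
      br (pair0 m (fst p) + fst p m - fst p (Suc m)) \<noteq> 0 \<and>
      (\<forall>i\<in>{1..<m}. br (fst p i - fst p m) \<noteq> 0 \<and> br (fst p i - fst p (Suc m)) \<noteq> 0) \<and>
      snd (snd p) m \<noteq> 0 \<and> snd (snd p) (Suc m) \<noteq> 0)"
    by (intro generic_conj generic_y)
  then show ?thesis by (rule generic_mono) (simp add: regular_def Let_def)
qed

lemma open_regular: "open (Collect regular)"
proof -
  have e: "Collect regular = {p. br (pair0 m (fst p)) \<noteq> 0} \<inter>
      {p. br (pair0 m (fst p) + fst p m - fst p (Suc m)) \<noteq> 0} \<inter>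
      (\<Inter>i\<in>{1..<m}. {p. br (fst p i - fst p m) \<noteq> 0} \<inter> {p. br (fst p i - fst p (Suc m)) \<noteq> 0}) \<inter>
      {p. snd (snd p) m \<noteq> 0} \<inter> {p. snd (snd p) (Suc m) \<noteq> 0}"
    by (auto simp: regular_def Let_def)
  show ?thesis unfolding e
    by (intro open_Int open_INT finite_atLeastLessThan ballI open_Collect_neq continuous_on_br
        continuous_intros continuous_on_pair0 continuous_on_h continuous_on_y)
qed

lemma continuous_on_cstep:
  assumes "k = m \<Longrightarrow> S \<subseteq> Collect regular"
  shows "continuous_on S (cstep k)"
  unfolding cstep_def Let_def
proof (intro continuous_on_Pair continuous_on_coordinatewise_then_product)
  fix t
  show "continuous_on S (\<lambda>p. root_refl m k (fst p) t)"
    unfolding root_refl_def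
    by (cases "k = 0"; cases "t = 0"; cases "t \<le> m")
      (auto intro!: continuous_intros continuous_on_h continuous_on_pair0)
next
  fix i
  have "continuous_on S (\<lambda>p. cross (pair0 m (fst p)) (fst p i) (fst p m) (fst p (Suc m)) (fst (snd p) i)
      (fst (snd p) m) (snd (snd p) i) (snd (snd p) m) (snd (snd p) (Suc m)))"
    if "k = m" "1 \<le> i" "i < m" unfolding cross_def
    using assms that by (intro continuous_intros continuous_on_br continuous_on_h continuous_on_u
        continuous_on_y continuous_on_pair0) (fastforce simp: regular_def Let_def)
  then show "continuous_on S (\<lambda>p. if i < 1 \<or> m < i then fst (snd p) i else if k = 0 then snd (snd p) i
       else if k < m then fst (snd p) (transp k i) else if k = m \<and> i \<noteq> m
       then cross (pair0 m (fst p)) (fst p i) (fst p m) (fst p (Suc m)) (fst (snd p) i)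
      (fst (snd p) m) (snd (snd p) i) (snd (snd p) m) (snd (snd p) (Suc m)) else fst (snd p) i)"
    by (cases "i < 1 \<or> m < i"; cases "k = 0"; cases "k < m"; cases "k = m"; cases "i = m")
      (auto intro!: continuous_on_u continuous_on_y)
next
  fix j
  show "continuous_on S (\<lambda>p. (if k = 0 then (\<lambda>j. if 1 \<le> j \<and> j \<le> m then fst (snd p) j
      else snd (snd p) j) else snd (snd p) \<circ> transp k) j)"
    by (cases "k = 0"; cases "1 \<le> j \<and> j \<le> m") (auto intro!: continuous_on_u continuous_on_y)
qed

lemma regular_cstep:
  assumes "regular p"
  shows "regular (cstep m p)"
proof -
  obtain h u y where p: "p = (h, u, y)" by (cases p)
  show ?thesis using assms m_ge
    by (auto simp: p regular_def cstep_def Let_def pair0_root_refl_m) (auto simp: root_refl_m)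
qed

text \<open>\<open>cstep k\<close> is its own continuous inverse, on the regular set for
  \<open>k = m\<close> and everywhere otherwise, so it can serve as \<open>G\<close> in
  \<open>generic_pullback\<close>.\<close>

lemma generic_cstep:
  assumes "generic P"
  shows "generic (\<lambda>p. P (cstep k p))"
proof (cases "k = m")
  case True
  have "generic (\<lambda>p. p \<in> Collect regular \<and> P (cstep k p))"
    by (rule generic_pullback[OF assms open_regular generic_imp_closure[OF generic_regular] open_regular,
          where G="cstep k"])
      (use True in \<open>auto intro: continuous_on_cstep regular_cstep cstep_cstep\<close>)
  then show ?thesis by (rule generic_mono) simp
next
  case False
  have "generic (\<lambda>p. p \<in> UNIV \<and> P (cstep k p))"
    by (rule generic_pullback[where U'=UNIV and G="cstep k"])
      (use False assms in \<open>auto intro: continuous_on_cstep cstep_cstep\<close>)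
  then show ?thesis by (rule generic_mono) simp
qed

definition gen_eq :: "(point \<Rightarrow> complex) \<Rightarrow> (point \<Rightarrow> complex) \<Rightarrow> bool" where
  "gen_eq F G \<longleftrightarrow> generic (\<lambda>p. F p = G p)"

definition cact :: "nat \<Rightarrow> (point \<Rightarrow> complex) \<Rightarrow> point \<Rightarrow> complex" where
  "cact k F = (\<lambda>p. F (cstep k p))"

text \<open>The only nonzero pairing of \<open>e_n\<close> is -1, with \<open>h_{n-1}\<close>. All
  other generators fix the coordinate \<tau>_n, including \<open>s_0\<close>, because
  \<open>n > m\<close>.\<close>

sublocale orbit_cocycle "{..<n}" "root_refl m" "root_pair m" "adjacent m" cact gen_eq
  "evec n" "\<lambda>p. snd (snd p) n"
proof
  fix k l v F G H
  show "root_refl m k (root_refl m k v) = v" by (rule root_refl_refl)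
  show "root_pair m k v = 0 \<Longrightarrow> root_refl m k v = v" by (rule root_refl_fix)
  show "root_pair m k (root_refl m k v) = - root_pair m k v" by (rule root_pair_refl_self)
  show "k \<noteq> l \<Longrightarrow> \<not> adjacent m k l \<Longrightarrow> root_pair m k (root_refl m l v) = root_pair m k v"
    using m_ge by (intro root_pair_refl_comm) auto
  show "adjacent m k l \<Longrightarrow> root_pair m k (root_refl m l v) = root_pair m k v + root_pair m l v"
    using m_ge by (intro root_pair_refl_adj) auto
  show "k \<noteq> l \<Longrightarrow> \<not> adjacent m k l \<Longrightarrow> root_refl m k (root_refl m l v) = root_refl m l (root_refl m k v)"
    by (rule root_refl_comm)
  show "adjacent m k l \<Longrightarrow> root_refl m k (root_refl m l (root_refl m k v)) =
      root_refl m l (root_refl m k (root_refl m l v))"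
    using m_ge by (intro root_refl_braid) auto
  show "adjacent m k l \<Longrightarrow> adjacent m l k" by (auto simp: adjacent_def)
  show "gen_eq F F" by (simp add: gen_eq_def generic_True)
  show "gen_eq F G \<Longrightarrow> gen_eq G F" by (simp add: gen_eq_def eq_commute)
  show "gen_eq F G \<Longrightarrow> gen_eq G H \<Longrightarrow> gen_eq F H"
    unfolding gen_eq_def by (drule (1) generic_conj) (erule generic_mono, auto)
  show "gen_eq F G \<Longrightarrow> gen_eq (cact k F) (cact k G)"
    unfolding gen_eq_def cact_def by (rule generic_cstep)
  show "gen_eq (cact k (cact k F)) F"
    unfolding gen_eq_def cact_def by (rule generic_mono[OF generic_regular]) (simp add: cstep_cstep)
  show "k \<noteq> l \<Longrightarrow> \<not> adjacent m k l \<Longrightarrow> gen_eq (cact k (cact l F)) (cact l (cact k F))"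
    unfolding gen_eq_def cact_def using cstep_comm[of k l] by (simp add: generic_True)
  show "adjacent m k l \<Longrightarrow> gen_eq (cact k (cact l (cact k F))) (cact l (cact k (cact l F)))"
    unfolding gen_eq_def cact_def
    by (rule generic_mono[OF generic_regular]) (simp add: cstep_braid[of _ k l])
  assume k: "k \<in> {..<n}"
  have p0: "pair0 m (evec n) = (0::int)" using m_less m_ge by (simp add: pair0_def evec_def)
  show "root_pair m k (evec n) \<le> 0" using k p0 by (auto simp: root_pair_def evec_def)
  assume "root_pair m k (evec n) = 0"
  then have "k = 0 \<or> transp k n = n" using k by (auto simp: root_pair_def evec_def transp_def split: if_splits)
  then have "cact k (\<lambda>p. snd (snd p) n) = (\<lambda>p. snd (snd p) n)"
    using m_less by (auto simp: cact_def cstep_def Let_def fun_eq_iff)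
  then show "gen_eq (cact k (\<lambda>p. snd (snd p) n)) (\<lambda>p. snd (snd p) n)"
    by (simp add: gen_eq_def generic_True)
qed

end

subsection \<open>Words of adjacent transpositions\<close>

lemma foldr_transp_rev [simp]:
  "foldr transp ws (foldr transp (rev ws) i) = i"
  "foldr transp (rev ws) (foldr transp ws i) = i"
  by (induction ws arbitrary: i) simp_all

lemma foldr_transp_fix: "\<forall>k\<in>set ws. i < k \<Longrightarrow> foldr transp ws i = i"
  by (induction ws) simp_all

lemma foldr_transp_range:
  "set ws \<subseteq> {1..<n} \<Longrightarrow> i \<in> {1..n} \<Longrightarrow> foldr transp ws i \<in> {1..n}"
  by (induction ws) (auto simp: transp_def)

lemma transp_word_single:
  assumes "a \<le> b" "b \<le> n"
  shows "\<exists>ws. set ws \<subseteq> {a..<n} \<and> foldr transp ws a = b"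
  using assms
proof (induction b rule: dec_induct)
  case base
  then show ?case by (intro exI[of _ "[]"]) simp
next
  case (step b)
  then obtain ws where "set ws \<subseteq> {a..<n}" "foldr transp ws a = b" by auto
  then show ?case using step by (intro exI[of _ "b # ws"]) auto
qed

lemma transp_word_from_last:
  assumes "1 \<le> a" "a \<le> n"
  shows "\<exists>ws. set ws \<subseteq> {1..<n} \<and> foldr transp ws n = a"
proof -
  obtain ws where ws: "set ws \<subseteq> {a..<n}" "foldr transp ws a = n"
    using transp_word_single[OF assms(2) order_refl] by blast
  have "foldr transp (rev ws) n = a" using foldr_transp_rev(2)[of ws a] ws(2) by simp
  moreover have "{a..<n} \<subseteq> {1..<n}" using assms by auto
  then have "set (rev ws) \<subseteq> {1..<n}" using ws(1) by (simp only: set_rev)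
  ultimately show ?thesis by blast
qed

text \<open>Extends the word one index at a time. The preimage \<open>z\<close> of
  \<open>f (Suc q)\<close> under the word found so far exceeds \<open>q\<close> by injectivity, so
  \<open>Suc q\<close> can be moved to \<open>z\<close> first by letters above \<open>q\<close>,
  which leave \<open>1, ..., q\<close> alone.\<close>

lemma transp_word_exists:
  assumes "q \<le> n" "inj_on f {1..q}" "f ` {1..q} \<subseteq> {1..n}"
  shows "\<exists>ws. set ws \<subseteq> {1..<n} \<and> (\<forall>r\<in>{1..q}. foldr transp ws r = f r)"
  using assms
proof (induction q)
  case 0
  then show ?case by (intro exI[of _ "[]"]) simp
next
  case (Suc q)
  have "inj_on f {1..q}" "f ` {1..q} \<subseteq> {1..n}" "q \<le> n"
    using Suc.prems by (auto intro: inj_on_subset)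
  then obtain ws where ws: "set ws \<subseteq> {1..<n}" "\<And>r. r \<in> {1..q} \<Longrightarrow> foldr transp ws r = f r"
    using Suc.IH by blast
  define z where "z = foldr transp (rev ws) (f (Suc q))"
  have z: "z \<in> {1..n}" unfolding z_def using ws(1) Suc.prems(3)
    by (intro foldr_transp_range) (auto simp: image_subset_iff)
  have fz: "foldr transp ws z = f (Suc q)" by (simp add: z_def)
  have "\<not> z \<le> q"
  proof
    assume "z \<le> q"
    then have "f z = f (Suc q)" "z \<in> {1..q}" using ws(2)[of z] fz z by auto
    then show False using inj_onD[OF Suc.prems(2), of z "Suc q"] by auto
  qed
  then obtain vs where vs: "set vs \<subseteq> {Suc q..<n}" "foldr transp vs (Suc q) = z"
    using transp_word_single[of "Suc q" z n] z by auto
  have "foldr transp (ws @ vs) r = f r" if r: "r \<in> {1..Suc q}" for r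
  proof (cases "r = Suc q")
    case True
    then show ?thesis using vs fz by simp
  next
    case False
    moreover have "foldr transp vs r = r" using vs(1) r False by (intro foldr_transp_fix) auto
    ultimately show ?thesis using ws(2)[of r] r by auto
  qed
  moreover have "set (ws @ vs) \<subseteq> {1..<n}" using ws vs by fastforce
  ultimately show ?case by blast
qed

lemma evec_foldr_transp: "evec j (foldr transp (rev ws) t) = evec (foldr transp ws j) t"
  by (metis evec_def foldr_transp_rev)

lemma foldr_root_refl_transp:
  assumes "0 \<notin> set ws"
  shows "foldr (root_refl m) ws a t = a (foldr transp (rev ws) t)"
  using assms by (induction ws arbitrary: t) (auto simp: root_refl_transp)

section \<open>From words in the given generators to steps on points\<close>

context tau_system
begin

lemma lat_act_eq: "set ws \<subseteq> {..<n} \<Longrightarrow> lat_act m n ws a = foldr (root_refl m) ws a"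
  unfolding lat_act_def using m_less by (induction ws) (auto simp: lrefl_eq)

text \<open>Substitution reverses composition: the first letter of the word is the first to move the
  point.\<close>

lemma foldr_cact: "foldr cact ws F p = F (fold cstep ws p)"
  by (induction ws arbitrary: p) (simp_all add: cact_def)

lemma fold_cstep_transp:
  assumes "0 \<notin> set ws"
  shows "fst (fold cstep ws p) t = fst p (foldr transp ws t)"
    "snd (snd (fold cstep ws p)) t = snd (snd p) (foldr transp ws t)"
  using assms by (induction ws arbitrary: p)
    (auto simp: cstep_def Let_def root_refl_transp)

lemma generic_fold_cstep: "generic P \<Longrightarrow> generic (\<lambda>p. P (fold cstep ws p))"
  by (induction ws) (auto dest: generic_cstep)

definition homog :: "point \<Rightarrow> point" where
  "homog p = (fst p, (\<lambda>i. if 1 \<le> i \<and> i \<le> m then snd (snd p) i * fst (snd p) i else fst (snd p) i),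
     snd (snd p))"

text \<open>Nonvanishing permits the cancellations: \<open>s_0\<close> yields
  \<open>y i * x i * (1 / x i) = y i\<close>, and \<open>s_m\<close> at \<open>i = m\<close> cancels
  \<open>y (m+1)\<close>.\<close>

lemma homog_step:
  assumes k: "k < n" and y: "\<And>j. j \<in> {1..Suc m} \<Longrightarrow> y j \<noteq> 0" and x: "\<And>j. j \<in> {1..m} \<Longrightarrow> x j \<noteq> 0"
  shows "homog (hrefl m n k h, fimg br m n k h x y, timg m k x y) = cstep k (homog (h, x, y))"
proof -
  have e: "eps m n j h = h j" if "1 \<le> j" "j \<le> Suc m" for j
    using that m_less by (intro eps_eq) auto
  have a: "alpha m n 0 h = pair0 m h" using m_less by (simp add: alpha_eq root_pair_def)
  have f: "timg m k x y i * fimg br m n k h x y i = fst (snd (cstep k (homog (h, x, y)))) i"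
    if i: "1 \<le> i" "i \<le> m" for i
  proof -
    consider "k = 0" | "0 < k" "k < m" | "k = m" "i = m" | "k = m" "i < m" | "m < k" using i by linarith
    then show ?thesis
    proof cases
      case 1
      then show ?thesis using i x[of i] by (simp add: timg_def fimg_def cstep_def homog_def Let_def)
    next
      case 2
      then show ?thesis using i
        by (auto simp: timg_def fimg_def cstep_def homog_def Let_def) (auto simp: transp_def)
    next
      case 3
      then show ?thesis using i y[of "Suc m"]
        by (simp add: timg_def fimg_def cstep_def homog_def Let_def)
    next
      case 4
      have "timg m k x y i * fimg br m n k h x y i = cross (pair0 m h) (h i) (h m) (h (Suc m))
          (y i * x i) (y m * x m) (y i) (y m) (y (Suc m))"
        using 4 i by (simp add: timg_def fimg_def eps2_def e a cross_def)
          (simp add: divide_simps add_diff_eq, simp add: algebra_simps)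
      then show ?thesis using 4 i by (simp add: cstep_def homog_def Let_def)
    next
      case 5
      then show ?thesis using i
        by (simp add: timg_def fimg_def cstep_def homog_def Let_def)
    qed
  qed
  have g: "fimg br m n k h x y i = fst (snd (cstep k (homog (h, x, y)))) i" if "i < 1 \<or> m < i" for i
    using that by (auto simp: fimg_def cstep_def homog_def Let_def)
  have t: "timg m k x y = snd (snd (cstep k (homog (h, x, y))))"
    by (auto simp: timg_def cstep_def homog_def Let_def fun_eq_iff)
  have h: "hrefl m n k h = fst (cstep k (homog (h, x, y)))"
    using k m_less by (simp add: hrefl_eq cstep_def homog_def Let_def)
  show ?thesis
    unfolding prod_eq_iff using f g h t
    by (auto simp: homog_def[of "(hrefl m n k h, fimg br m n k h x y, timg m k x y)"] fun_eq_iff)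
qed

text \<open>The exceptional set depends on the word, since coordinates must be nonzero at every
  point visited: each further letter adds conditions of its own and pulls the earlier ones back
  along \<open>cstep k\<close>.\<close>

lemma word_act_generic:
  assumes "set ws \<subseteq> {..<n}"
  shows "\<exists>P. generic P \<and> (\<forall>h x y. P (homog (h, x, y)) \<longrightarrow>
    word_act br m n ws (tau_gen n) h x y = foldr cact ws (\<lambda>p. snd (snd p) n) (homog (h, x, y)))"
  using assms
proof (induction ws)
  case Nil
  then show ?case
    by (intro exI[of _ "\<lambda>_. True"]) (simp add: generic_True word_act_def tau_gen_def homog_def)
next
  case (Cons k ws)
  then obtain P where P: "generic P" "\<And>h x y. P (homog (h, x, y)) \<Longrightarrow>
    word_act br m n ws (tau_gen n) h x y = foldr cact ws (\<lambda>p. snd (snd p) n) (homog (h, x, y))"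
    by auto
  define Q where "Q p \<longleftrightarrow> (\<forall>j\<in>{1..Suc m}. snd (snd p) j \<noteq> 0) \<and> (\<forall>j\<in>{1..m}. fst (snd p) j \<noteq> 0)
     \<and> P (cstep k p)" for p
  have "generic Q" unfolding Q_def
    by (intro generic_conj generic_ball generic_u generic_y generic_cstep P) auto
  moreover have "word_act br m n (k # ws) (tau_gen n) h x y =
      foldr cact (k # ws) (\<lambda>p. snd (snd p) n) (homog (h, x, y))" if "Q (homog (h, x, y))" for h x y
  proof -
    have "homog (hrefl m n k h, fimg br m n k h x y, timg m k x y) = cstep k (homog (h, x, y))"
      using that Cons.prems by (intro homog_step) (auto simp: Q_def homog_def)
    moreover have "word_act br m n (k # ws) (tau_gen n) h x y =
        word_act br m n ws (tau_gen n) (hrefl m n k h) (fimg br m n k h x y) (timg m k x y)"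
      by (simp add: word_act_def act_def)
    ultimately show ?thesis using P(2) that by (simp add: Q_def cact_def)
  qed
  ultimately show ?case by blast
qed

lemma generic_homog:
  assumes "generic P"
  shows "generic (\<lambda>p. P (homog p))"
proof -
  define U :: "point set" where "U = {p. \<forall>j\<in>{1..m}. snd (snd p) j \<noteq> 0}"
  define G :: "point \<Rightarrow> point" where "G = (\<lambda>p. (fst p,
     (\<lambda>i. if 1 \<le> i \<and> i \<le> m then fst (snd p) i / snd (snd p) i else fst (snd p) i), snd (snd p)))"
  have "U = (\<Inter>j\<in>{1..m}. {p. snd (snd p) j \<noteq> 0})" by (auto simp: U_def)
  then have o: "open U"
    by (auto intro!: open_INT open_Collect_neq continuous_on_y continuous_intros)
  have "generic (\<lambda>p::point. \<forall>j\<in>{1..m}. snd (snd p) j \<noteq> 0)" by (intro generic_ball generic_y) auto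
  then have c: "closure U = UNIV" unfolding U_def by (rule generic_imp_closure)
  have "continuous_on U (\<lambda>p. if 1 \<le> i \<and> i \<le> m then snd (snd p) i * fst (snd p) i else fst (snd p) i)" for i
    by (cases "1 \<le> i \<and> i \<le> m") (auto intro!: continuous_intros continuous_on_u continuous_on_y)
  then have h: "continuous_on U homog"
    unfolding homog_def
    by (intro continuous_on_Pair continuous_on_coordinatewise_then_product continuous_on_h continuous_on_y)
  have "continuous_on U (\<lambda>p. if 1 \<le> i \<and> i \<le> m then fst (snd p) i / snd (snd p) i else fst (snd p) i)" for i
    by (cases "1 \<le> i \<and> i \<le> m")
      (auto intro!: continuous_intros continuous_on_u continuous_on_y simp: U_def)
  then have G: "continuous_on U G"
    unfolding G_def
    by (intro continuous_on_Pair continuous_on_coordinatewise_then_product continuous_on_h continuous_on_y)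
  have "generic (\<lambda>p. p \<in> U \<and> P (homog p))"
    by (rule generic_pullback[OF assms o c o h G])
      (auto simp: U_def G_def homog_def fun_eq_iff)
  then show ?thesis by (rule generic_mono) simp
qed

text \<open>Lets an arbitrary word for a lattice vector be traded for a convenient one, whose value
  can be computed by moving the point.\<close>

lemma generic_word_act:
  assumes "set ws \<subseteq> {..<n}" "set ws' \<subseteq> {..<n}" "lat_act m n ws (evec n) = lat_act m n ws' (evec n)"
  shows "generic (\<lambda>p. word_act br m n ws (tau_gen n) (fst p) (fst (snd p)) (snd (snd p))
    = snd (snd (fold cstep ws' (homog p))) n)"
proof -
  have "foldr (root_refl m) ws (evec n) = foldr (root_refl m) ws' (evec n)"
    using assms lat_act_eq by metis
  then have "gen_eq (foldr cact ws (\<lambda>p. snd (snd p) n)) (foldr cact ws' (\<lambda>p. snd (snd p) n))"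
    using assms by (intro word_unique)
  then have 1: "generic (\<lambda>p. foldr cact ws (\<lambda>p. snd (snd p) n) p = snd (snd (fold cstep ws' p)) n)"
    unfolding gen_eq_def foldr_cact .
  obtain P where P: "generic P" "\<And>h x y. P (homog (h, x, y)) \<Longrightarrow>
    word_act br m n ws (tau_gen n) h x y = foldr cact ws (\<lambda>p. snd (snd p) n) (homog (h, x, y))"
    using word_act_generic assms by blast
  show ?thesis
    by (rule generic_mono[OF generic_homog[OF generic_conj[OF P(1) 1]]]) (auto dest: P(2))
qed

text \<open>\<open>s_0 e_j\<close> is \<open>e_0\<close> minus all \<open>e_r\<close> with
  \<open>1 \<le> r \<le> m\<close>, \<open>r \<noteq> j\<close>. Hence the indices cross over:
  starting from \<open>e_m\<close> gives \<Lambda> - e_{m-1} and starting from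
  \<open>e_{m-1}\<close> gives \<Lambda> - e_m, which \<open>s_m\<close> turns into \<Lambda> -
  e_{m+1}.\<close>

lemma lat_act_lines:
  assumes "set ws \<subseteq> {1..<n}" "foldr transp ws n = m - 1"
    and "set ws' \<subseteq> {1..<n}" "foldr transp ws' n = m"
  defines "\<Lambda> \<equiv> \<lambda>t. evec 0 t - (\<Sum>r=1..m-2. evec r t)"
  shows "lat_act m n (0 # ws') (evec n) = (\<lambda>t. \<Lambda> t - evec (m - 1) t)"
    "lat_act m n (0 # ws) (evec n) = (\<lambda>t. \<Lambda> t - evec m t)"
    "lat_act m n (m # 0 # ws) (evec n) = (\<lambda>t. \<Lambda> t - evec (Suc m) t)"
proof -
  have E: "foldr (root_refl m) vs (evec n) = evec (foldr transp vs n)" if "set vs \<subseteq> {1..<n}" for vs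
  proof -
    have "0 \<notin> set vs" using that by auto
    then show ?thesis by (simp add: fun_eq_iff foldr_root_refl_transp evec_foldr_transp)
  qed
  have P: "pair0 m (evec j) = -1" if "1 \<le> j" "j \<le> m" for j
    using that by (simp add: pair0_def evec_def)
  have S: "(\<Sum>r=1..m-2. evec r t) = (if 1 \<le> t \<and> t \<le> m - 2 then 1 else 0)" for t
    by (simp add: evec_def)
  have e: "lat_act m n (0 # ws') (evec n) = root_refl m 0 (evec m)"
    "lat_act m n (0 # ws) (evec n) = root_refl m 0 (evec (m - 1))"
  proof -
    have "set (0 # ws') \<subseteq> {..<n}" "set (0 # ws) \<subseteq> {..<n}"
      using assms(1,3) m_less by auto
    then show "lat_act m n (0 # ws') (evec n) = root_refl m 0 (evec m)"
      "lat_act m n (0 # ws) (evec n) = root_refl m 0 (evec (m - 1))"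
      by (simp_all only: lat_act_eq foldr.simps o_apply E[OF assms(1)] E[OF assms(3)] assms(2,4))
  qed
  have P': "pair0 m (evec m) = -1" "pair0 m (evec (m - 1)) = -1"
    using m_ge by (auto intro!: P)
  show "lat_act m n (0 # ws') (evec n) = (\<lambda>t. \<Lambda> t - evec (m - 1) t)"
    and 2: "lat_act m n (0 # ws) (evec n) = (\<lambda>t. \<Lambda> t - evec m t)"
    unfolding e fun_eq_iff root_refl_0 P' \<Lambda>_def S using m_ge by (auto simp: evec_def)
  have "lat_act m n (m # 0 # ws) (evec n) = root_refl m m (lat_act m n (0 # ws) (evec n))"
    using m_less by (simp add: lat_act_def lrefl_eq)
  then show "lat_act m n (m # 0 # ws) (evec n) = (\<lambda>t. \<Lambda> t - evec (Suc m) t)"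
    unfolding 2 using m_ge by (auto simp: root_refl_m fun_eq_iff \<Lambda>_def S evec_def transp_def)
qed

subsection \<open>The bilinear relation\<close>

theorem tau_relation:
  fixes l :: "nat \<Rightarrow> nat"
  assumes ijk: "i \<in> {1..n}" "j \<in> {1..n}" "k \<in> {1..n}" "i \<noteq> j" "j \<noteq> k" "i \<noteq> k"
    and l_range: "l ` {1..m-2} \<subseteq> {1..n}" and l_inj: "inj_on l {1..m-2}"
    and l_disj: "i \<notin> l ` {1..m-2}" "j \<notin> l ` {1..m-2}" "k \<notin> l ` {1..m-2}"
  defines "Lam \<equiv> \<lambda>t. evec 0 t - (\<Sum>r=1..m-2. evec (l r) t)"
    and "lam \<equiv> \<lambda>h. eps m n 0 h - (\<Sum>r=1..m-2. eps m n (l r) h)"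
  shows "\<forall>v\<in>{i,j,k}. \<exists>ws. set ws \<subseteq> {..<n} \<and> lat_act m n ws (evec n) = (\<lambda>t. Lam t - evec v t)"
    and "set wi \<subseteq> {..<n} \<Longrightarrow> set wj \<subseteq> {..<n} \<Longrightarrow> set wk \<subseteq> {..<n} \<Longrightarrow>
      lat_act m n wi (evec n) = (\<lambda>t. Lam t - evec i t) \<Longrightarrow>
      lat_act m n wj (evec n) = (\<lambda>t. Lam t - evec j t) \<Longrightarrow>
      lat_act m n wk (evec n) = (\<lambda>t. Lam t - evec k t) \<Longrightarrow>
      generic (\<lambda>p. let h = fst p; x = fst (snd p); y = snd (snd p) in
         br (eps2 m n j k h) * br (lam h - eps m n j h - eps m n k h)
           * y i * word_act br m n wi (tau_gen n) h x y
       + br (eps2 m n k i h) * br (lam h - eps m n k h - eps m n i h)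
           * y j * word_act br m n wj (tau_gen n) h x y
       + br (eps2 m n i j h) * br (lam h - eps m n i h - eps m n j h)
           * y k * word_act br m n wk (tau_gen n) h x y = 0)"
proof -
  \<comment> \<open>Relabelling of the model indices \<open>1, ..., m-2\<close>, \<open>m-1\<close>,
    \<open>m\<close>, \<open>m+1\<close> as \<open>l_1, ..., l_{m-2}\<close>, \<open>i\<close>,
    \<open>j\<close>, \<open>k\<close>.\<close>
  define f where "f r = (if r = Suc m then k else if r = m then j else if r = m - 1 then i else l r)" for r
  have f: "f (Suc m) = k" "f m = j" "f (m - 1) = i" "\<And>r. r \<in> {1..m-2} \<Longrightarrow> f r = l r"
    using m_ge by (auto simp: f_def)
  have D: "{1..Suc m} = insert (Suc m) (insert m (insert (m - 1) {1..m-2}))"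
    using m_ge by auto
  have im: "f ` {1..m-2} = l ` {1..m-2}" using f(4) by (intro image_cong) auto
  have "inj_on f {1..m-2}" using l_inj f(4) by (metis inj_on_cong)
  then have "inj_on f {1..Suc m}"
    unfolding D inj_on_insert using f(1-3) im ijk l_disj m_ge by (auto simp del: One_nat_def)
  moreover have "f ` {1..Suc m} \<subseteq> {1..n}"
    unfolding D image_insert im f(1-3) using l_range ijk by auto
  ultimately obtain vs where vs: "set vs \<subseteq> {1..<n}" "\<And>r. r \<in> {1..Suc m} \<Longrightarrow> foldr transp vs r = f r"
    using transp_word_exists[of "Suc m" n f] m_less by auto
  have vs0: "0 \<notin> set vs" using vs(1) by auto
  obtain ws where ws: "set ws \<subseteq> {1..<n}" "foldr transp ws n = m - 1"
  proof -
    have "1 \<le> m - 1" "m - 1 \<le> n" using m_ge m_less by simp_all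
    then show ?thesis using that transp_word_from_last by blast
  qed
  obtain ws' where ws': "set ws' \<subseteq> {1..<n}" "foldr transp ws' n = m"
    using transp_word_from_last[of m n] m_ge m_less by auto
  \<comment> \<open>The prefix \<open>vs\<close> relabels the model vectors. On points it acts
    before the rest of the word, so the model computation takes place at the permuted point.\<close>
  let ?wi = "vs @ 0 # ws'" and ?wj = "vs @ 0 # ws" and ?wk = "vs @ m # 0 # ws"
  have sets: "set ?wi \<subseteq> {..<n}" "set ?wj \<subseteq> {..<n}" "set ?wk \<subseteq> {..<n}"
    using vs ws ws' m_less by auto
  have v0: "foldr transp vs 0 = 0" using vs0 by (intro foldr_transp_fix) (metis gr0I)
  have vsum: "(\<Sum>r=1..m-2. evec (foldr transp vs r) t) = (\<Sum>r=1..m-2. evec (l r) t)" for t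
    using vs(2) f(4) m_ge by (intro sum.cong) auto
  have L: "lat_act m n vs (\<lambda>t. evec 0 t - (\<Sum>r=1..m-2. evec r t) - evec v t)
      = (\<lambda>t. Lam t - evec (f v) t)" if "v \<in> {1..Suc m}" for v
    using vs(1,2) that
    by (subst lat_act_eq)
      (auto simp: foldr_root_refl_transp vs0 evec_foldr_transp v0 vsum Lam_def fun_eq_iff simp del: One_nat_def)
  have lat: "lat_act m n ?wi (evec n) = (\<lambda>t. Lam t - evec i t)"
    "lat_act m n ?wj (evec n) = (\<lambda>t. Lam t - evec j t)"
    "lat_act m n ?wk (evec n) = (\<lambda>t. Lam t - evec k t)"
  proof -
    have app: "lat_act m n (vs @ w) (evec n) = lat_act m n vs (lat_act m n w (evec n))" for w
      by (simp add: lat_act_def)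
    show "lat_act m n ?wi (evec n) = (\<lambda>t. Lam t - evec i t)"
      unfolding app lat_act_lines(1)[OF ws ws'] f(3)[symmetric]
      using m_ge by (intro L) auto
    show "lat_act m n ?wj (evec n) = (\<lambda>t. Lam t - evec j t)"
      unfolding app lat_act_lines(2)[OF ws ws'] f(2)[symmetric]
      using m_ge by (intro L) auto
    show "lat_act m n ?wk (evec n) = (\<lambda>t. Lam t - evec k t)"
      unfolding app lat_act_lines(3)[OF ws ws'] f(1)[symmetric] by (intro L) auto
  qed
  show "\<forall>v\<in>{i,j,k}. \<exists>ws. set ws \<subseteq> {..<n} \<and> lat_act m n ws (evec n) = (\<lambda>t. Lam t - evec v t)"
  proof
    fix v assume "v \<in> {i,j,k}"
    then consider "v = i" | "v = j" | "v = k" by blast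
    then show "\<exists>ws. set ws \<subseteq> {..<n} \<and> lat_act m n ws (evec n) = (\<lambda>t. Lam t - evec v t)"
    proof cases
      case 1
      show ?thesis unfolding 1 using sets(1) lat(1) by blast
    next
      case 2
      show ?thesis unfolding 2 using sets(2) lat(2) by blast
    next
      case 3
      show ?thesis unfolding 3 using sets(3) lat(3) by blast
    qed
  qed
  assume w: "set wi \<subseteq> {..<n}" "set wj \<subseteq> {..<n}" "set wk \<subseteq> {..<n}"
    "lat_act m n wi (evec n) = (\<lambda>t. Lam t - evec i t)"
    "lat_act m n wj (evec n) = (\<lambda>t. Lam t - evec j t)"
    "lat_act m n wk (evec n) = (\<lambda>t. Lam t - evec k t)"
  define \<Theta> where "\<Theta> v p = snd (snd (fold cstep v (homog p))) n" for v p
  have base: "br (eps2 m n j k h) * br (lam h - eps m n j h - eps m n k h) * y i * \<Theta> ?wi (h, x, y)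
       + br (eps2 m n k i h) * br (lam h - eps m n k h - eps m n i h) * y j * \<Theta> ?wj (h, x, y)
       + br (eps2 m n i j h) * br (lam h - eps m n i h - eps m n j h) * y k * \<Theta> ?wk (h, x, y) = 0"
    if reg: "regular (fold cstep vs (homog (h, x, y)))" for h x y
  proof -
    obtain h' u' y' where q: "fold cstep vs (homog (h, x, y)) = (h', u', y')"
      by (cases "fold cstep vs (homog (h, x, y))")
    have h': "h' t = h (foldr transp vs t)" and y': "y' t = y (foldr transp vs t)" for t
      using fold_cstep_transp[OF vs0, of "homog (h, x, y)" t] q by (simp_all add: homog_def)
    have "m - 1 \<in> {1..Suc m}" "m \<in> {1..Suc m}" "Suc m \<in> {1..Suc m}" using m_ge by auto
    then have v: "foldr transp vs (m - 1) = i" "foldr transp vs m = j" "foldr transp vs (Suc m) = k"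
      by (simp_all only: vs(2) f(1-3))
    have ev: "eps m n i h = h' (m - 1)" "eps m n j h = h' m" "eps m n k h = h' (Suc m)"
      unfolding h' v using ijk by (simp_all add: eps_eq)
    have yv: "y i = y' (m - 1)" "y j = y' m" "y k = y' (Suc m)" by (simp_all only: y' v)
    have M: "{1..m} = insert m (insert (m - 1) {1..m-2})" using m_ge by auto
    have "(\<Sum>r=1..m-2. eps m n (l r) h) = (\<Sum>r=1..m-2. h' r)"
    proof (rule sum.cong)
      fix r assume r: "r \<in> {1..m-2}"
      then have "foldr transp vs r = l r" using vs(2)[of r] f(4)[of r] by auto
      moreover have "l r \<in> {1..n}" using l_range r by blast
      ultimately show "eps m n (l r) h = h' r" by (simp add: h' eps_eq)
    qed simp
    moreover have "(\<Sum>r=1..m. h' r) = h' m + (h' (m - 1) + (\<Sum>r=1..m-2. h' r))"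
    proof -
      have "m \<notin> insert (m - 1) {1..m-2}" "m - 1 \<notin> {1..m-2}" using m_ge by auto
      then show ?thesis unfolding M by simp
    qed
    \<comment> \<open>Equivalently \<lambda> - \<epsilon>_i - \<epsilon>_j is \<alpha>_0 at the
      permuted point.\<close>
    ultimately have lv: "lam h = pair0 m h' + h' (m - 1) + h' m"
      by (simp add: lam_def eps_0 pair0_def h' v0 del: One_nat_def)
    have ws0: "0 \<notin> set ws" "0 \<notin> set ws'" using ws ws' by auto
    have T: "\<Theta> ?wi (h, x, y) = u' m" "\<Theta> ?wj (h, x, y) = u' (m - 1)"
      "\<Theta> ?wk (h, x, y) = cross (pair0 m h') (h' (m - 1)) (h' m) (h' (Suc m)) (u' (m - 1)) (u' m)
         (y' (m - 1)) (y' m) (y' (Suc m))"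
    proof -
      have "1 \<le> m - 1" "m - 1 \<noteq> m" "\<not> m < m - 1" "m - 1 \<noteq> 0" "m - 1 \<le> m" "0 < m" using m_ge by auto
      then show "\<Theta> ?wi (h, x, y) = u' m" "\<Theta> ?wj (h, x, y) = u' (m - 1)"
        "\<Theta> ?wk (h, x, y) = cross (pair0 m h') (h' (m - 1)) (h' m) (h' (Suc m)) (u' (m - 1)) (u' m)
           (y' (m - 1)) (y' m) (y' (Suc m))"
        unfolding \<Theta>_def fold_append o_apply q fold.simps
          fold_cstep_transp(2)[OF ws0(1)] fold_cstep_transp(2)[OF ws0(2)] ws(2) ws'(2) cstep_def Let_def
        by simp_all
    qed
    have nz: "br (pair0 m h') \<noteq> 0" "br (h' (m - 1) - h' m) \<noteq> 0" "y' (Suc m) \<noteq> 0"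
      using reg m_ge by (auto simp: q regular_def Let_def)
    have e: "pair0 m h' + h' (m - 1) + h' m - h' m - h' (Suc m) = pair0 m h' + h' (m - 1) - h' (Suc m)"
      "pair0 m h' + h' (m - 1) + h' m - h' (Suc m) - h' (m - 1) = pair0 m h' + h' m - h' (Suc m)"
      "pair0 m h' + h' (m - 1) + h' m - h' (m - 1) - h' m = pair0 m h'"
      by simp_all
    \<comment> \<open>The factor of the third tau-function is exactly the denominator of
      \<open>cross\<close>, so that summand becomes the numerator, whose two terms cancel the first
      two summands.\<close>
    show ?thesis
      unfolding T eps2_def ev yv lv e cross_def br_diff_swap[of "h' (Suc m)" "h' (m - 1)"]
      using nz by (simp add: divide_simps)
  qed
  have "generic (\<lambda>p. regular (fold cstep vs (homog p)))"
    by (intro generic_homog generic_fold_cstep generic_regular)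
  moreover have "generic (\<lambda>p. word_act br m n wi (tau_gen n) (fst p) (fst (snd p)) (snd (snd p)) = \<Theta> ?wi p)"
    "generic (\<lambda>p. word_act br m n wj (tau_gen n) (fst p) (fst (snd p)) (snd (snd p)) = \<Theta> ?wj p)"
    "generic (\<lambda>p. word_act br m n wk (tau_gen n) (fst p) (fst (snd p)) (snd (snd p)) = \<Theta> ?wk p)"
    unfolding \<Theta>_def by (rule generic_word_act; use w sets lat in simp)+
  ultimately have "generic (\<lambda>p. regular (fold cstep vs (homog p)) \<and>
     word_act br m n wi (tau_gen n) (fst p) (fst (snd p)) (snd (snd p)) = \<Theta> ?wi p \<and>
     word_act br m n wj (tau_gen n) (fst p) (fst (snd p)) (snd (snd p)) = \<Theta> ?wj p \<and>
     word_act br m n wk (tau_gen n) (fst p) (fst (snd p)) (snd (snd p)) = \<Theta> ?wk p)"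
    by (intro generic_conj)
  then show "generic (\<lambda>p. let h = fst p; x = fst (snd p); y = snd (snd p) in
         br (eps2 m n j k h) * br (lam h - eps m n j h - eps m n k h)
           * y i * word_act br m n wi (tau_gen n) h x y
       + br (eps2 m n k i h) * br (lam h - eps m n k h - eps m n i h)
           * y j * word_act br m n wj (tau_gen n) h x y
       + br (eps2 m n i j h) * br (lam h - eps m n i h - eps m n j h)
           * y k * word_act br m n wk (tau_gen n) h x y = 0)"
  proof (rule generic_mono)
    fix p :: point
    obtain h x y where p: "p = (h, x, y)" by (cases p)
    assume "regular (fold cstep vs (homog p)) \<and>
      word_act br m n wi (tau_gen n) (fst p) (fst (snd p)) (snd (snd p)) = \<Theta> ?wi p \<and>
      word_act br m n wj (tau_gen n) (fst p) (fst (snd p)) (snd (snd p)) = \<Theta> ?wj p \<and>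
      word_act br m n wk (tau_gen n) (fst p) (fst (snd p)) (snd (snd p)) = \<Theta> ?wk p"
    then show "let h = fst p; x = fst (snd p); y = snd (snd p) in
         br (eps2 m n j k h) * br (lam h - eps m n j h - eps m n k h)
           * y i * word_act br m n wi (tau_gen n) h x y
       + br (eps2 m n k i h) * br (lam h - eps m n k h - eps m n i h)
           * y j * word_act br m n wj (tau_gen n) h x y
       + br (eps2 m n i j h) * br (lam h - eps m n i h - eps m n j h)
           * y k * word_act br m n wk (tau_gen n) h x y = 0"
      using base[of h x y] unfolding p Let_def fst_conv snd_conv by (elim conjE) (simp only:)
  qed
qed

end

text \<open>A tau-function is given by any word reaching its lattice vector. The existence clause
  shows that the three vectors lie in the orbit of \<open>e_n\<close>; allowing arbitrary, unrelated
  words in the second clause builds in independence of the choice.\<close>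

theorem theorem4:
  fixes br :: "complex \<Rightarrow> complex" and m n i j k :: nat and l :: "nat \<Rightarrow> nat"
  assumes br_holo: "br holomorphic_on UNIV"
    and br_odd: "\<forall>z. br (- z) = - br z"
    and br_nz: "\<exists>z. br z \<noteq> 0"
    and br_rel: "\<forall>x y u v. br (x+y) * br (x-y) * br (u+v) * br (u-v)
                   = br (x+u) * br (x-u) * br (y+v) * br (y-v)
                   - br (x+v) * br (x-v) * br (y+u) * br (y-u)"
    and mn: "3 \<le> m" "m < n"
    and ijk: "i \<in> {1..n}" "j \<in> {1..n}" "k \<in> {1..n}" "i \<noteq> j" "j \<noteq> k" "i \<noteq> k"
    and l_range: "l ` {1..m-2} \<subseteq> {1..n}" and l_inj: "inj_on l {1..m-2}"
    and l_disj: "i \<notin> l ` {1..m-2}" "j \<notin> l ` {1..m-2}" "k \<notin> l ` {1..m-2}"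
  shows "let Lam = (\<lambda>t. evec 0 t - (\<Sum>r=1..m-2. evec (l r) t));
             lam = (\<lambda>h. eps m n 0 h - (\<Sum>r=1..m-2. eps m n (l r) h))
         in (\<forall>v\<in>{i,j,k}. \<exists>ws. set ws \<subseteq> {..<n} \<and>
                lat_act m n ws (evec n) = (\<lambda>t. Lam t - evec v t))
          \<and> (\<forall>wi wj wk. set wi \<subseteq> {..<n} \<longrightarrow> set wj \<subseteq> {..<n} \<longrightarrow> set wk \<subseteq> {..<n} \<longrightarrow>
               lat_act m n wi (evec n) = (\<lambda>t. Lam t - evec i t) \<longrightarrow>
               lat_act m n wj (evec n) = (\<lambda>t. Lam t - evec j t) \<longrightarrow>
               lat_act m n wk (evec n) = (\<lambda>t. Lam t - evec k t) \<longrightarrow>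
               (\<exists>S :: ((nat \<Rightarrow> complex) \<times> (nat \<Rightarrow> complex) \<times> (nat \<Rightarrow> complex)) set.
                  open S \<and> closure S = UNIV \<and>
                  (\<forall>p\<in>S. let h = fst p; x = fst (snd p); y = snd (snd p) in
                     br (eps2 m n j k h) * br (lam h - eps m n j h - eps m n k h)
                       * y i * word_act br m n wi (tau_gen n) h x y
                   + br (eps2 m n k i h) * br (lam h - eps m n k h - eps m n i h)
                       * y j * word_act br m n wj (tau_gen n) h x y
                   + br (eps2 m n i j h) * br (lam h - eps m n i h - eps m n j h)
                       * y k * word_act br m n wk (tau_gen n) h x y = 0)))"
proof -
  interpret tau_system br m n
    by (rule tau_system.intro[OF br_holo br_odd[rule_format] br_nz br_rel[rule_format] mn])
  note rel = tau_relation[OF ijk l_range l_inj l_disj, unfolded generic_def]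
  show ?thesis
    unfolding Let_def
    by (rule conjI[OF rel(1)], intro allI impI, rule rel(2)[unfolded Let_def]; assumption)
qed

end
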